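(* Let $\mathcal{S}$ be a federated Byzantine quorum system over $\mathbf{V}$ with quorum intersection. Fix the sets of faulty and correct servers such that at least one intact server exists in $\mathcal{S}$, and let $(\mathcal{Q},\mathcal{B})$ be the dissemination quorum system that $\mathcal{S}$ induces. Then: (i) for every execution of Bracha broadcast over $(\mathcal{Q},\mathcal{B})$ with a history $H$, there exists an execution of the relaxed Stellar broadcast over $\mathcal{S}$ that also has history $H$; (ii) for every execution of the relaxed Stellar broadcast over $\mathcal{S}$ with a history $H$, there exists an execution of Bracha broadcast over $(\mathcal{Q},\mathcal{B})$ with history $H$.
   Context: System model. There is a set of clients $\mathbf{C}$ and a disjoint finite non-empty set of servers $\mathbf{V}$. In an execution each node (client or server) is either correct (follows its protocol) or faulty (Byzantine: behaves arbitrarily). One distinguished client $c$ is the sender; it may be correct or faulty. Any two nodes communicate over an asynchronous point-to-point channel. If both endpoints are correct, the channel is authenticated and reliable: a correct node receives (eventually, after an arbitrary finite delay) a message from another correct node if and only if the latter sent it. Servers also send messages to themselves. Executions are complete: a handler of a correct server that stays enabled is eventually executed. A correct sender broadcasts at most one value. All servers act according to the same FBQS $\mathcal{S}$. History. The history of an execution of a broadcast protocol is the set of events of the execution consisting of the reception of the first $\mathtt{BCAST}$ message (with its value) received by each server, and the triggering of the deliver primitive (with its value) by each server. Federated Byzantine quorum system (FBQS) over $\mathbf{V}$: a function $\mathcal{S}$ assigning to each $v\in\mathbf{V}$ a non-empty set $\mathcal{S}(v)\subseteq 2^{\mathbf{V}}$ of quorum slices, with $v\in q$ for all $q\in\mathcal{S}(v)$.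 A non-empty $U\subseteq\mathbf{V}$ is a quorum in $\mathcal{S}$ if $\forall v\in U.\ \exists q\in\mathcal{S}(v).\ q\subseteq U$. $\mathcal{S}$ has quorum intersection if any two of its quorums intersect. For $I\subseteq\mathbf{V}$, $\mathcal{S}|_I$ is the FBQS over universe $I$ with $\mathcal{S}|_I(v)=\{q\cap I\mid q\in\mathcal{S}(v)\}$. Given a set of faulty servers $\mathbf{V}_{\mathrm{bad}}$, the set $\mathbf{V}_{\mathrm{int}}$ of intact servers in $\mathcal{S}$ is the biggest set such that $\mathbf{V}_{\mathrm{int}}\cap\mathbf{V}_{\mathrm{bad}}=\emptyset$; if $\mathbf{V}_{\mathrm{int}}$ is non-empty then it is a quorum in $\mathcal{S}$; and $\mathcal{S}|_{\mathbf{V}_{\mathrm{int}}}$ has quorum intersection. (For FBQSes with quorum intersection this set exists and is unique.) A set $B\subseteq\mathbf{V}$ is $v$-blocking if $q\cap B\neq\emptyset$ for every $q\in\mathcal{S}(v)$. Induced DQS. $\mathcal{S}$ induces the pair $(\mathcal{Q},\mathcal{B})$ where $\mathcal{Q}$ is the set of all quorums in $\mathcal{S}$ and $\mathcal{B}$ consists of the inclusion-maximal sets $B\subseteq\mathbf{V}$ such that the set of intact servers in $\mathcal{S}$ with set of faulty servers $B$ is non-empty. This is a dissemination quorum system, i.e.: $\mathcal{Q}$ is non-empty, its elements are non-empty, pairwise intersecting, and closed under union; $\mathcal{B}$ is non-empty with no element contained in another; $\forall U_1,U_2\in\mathcal{Q}.\ \forall B\in\mathcal{B}.\ U_1\cap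 U_2\not\subseteq B$; and $\forall B\in\mathcal{B}.\ \exists U\in\mathcal{Q}.\ U\cap B=\emptyset$. Bracha broadcast over $(\mathcal{Q},\mathcal{B})$. To broadcast a value $a$, the sender $c$ sends $\mathtt{BCAST}(a)$ to every server. Each server has Boolean variables echoed, ready, delivered, all initially false, and the following handlers. (1) When it has received $\mathtt{BCAST}(a)$ from $c$ and echoed is false: set echoed to true and send $\mathtt{ECHO}(a)$ to every server. (2) When it has received $\mathtt{ECHO}(a)$ from every $u\in U$ for some $U\in\mathcal{Q}$, and ready is false: set ready to true and send $\mathtt{READY}(a)$ to every server. (3) When it has received $\mathtt{READY}(a)$ from every $u\in B$ for some non-empty $B\subseteq\mathbf{V}$ such that $B\not\subseteq B'$ for all $B'\in\mathcal{B}$, and ready is false: set ready to true and send $\mathtt{READY}(a)$ to every server. (4) When it has received $\mathtt{READY}(a)$ from every $u\in U$ for some $U\in\mathcal{Q}$, and delivered is false: set delivered to true and deliver $a$. Relaxed Stellar broadcast over $\mathcal{S}$. Identical to Bracha broadcast over $(\mathcal{Q},\mathcal{B})$ except that handler (3) at server $v$ is replaced by: when $v$ has received $\mathtt{READY}(a)$ from every $u\in B$ for some non-empty $v$-blocking $B\subseteq\mathbf{V}$, and ready is false: set ready to true and send $\mathtt{READY}(a)$ to every server. *)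

theory Defs
  imports Main
begin

section \<open>Federated Byzantine quorum systems\<close>

definition fbqs :: "'n set \<Rightarrow> ('n \<Rightarrow> 'n set set) \<Rightarrow> bool" where
  "fbqs V S \<longleftrightarrow> (\<forall>v\<in>V. S v \<noteq> {} \<and> (\<forall>q\<in>S v. q \<subseteq> V \<and> v \<in> q))"

definition quorum :: "'n set \<Rightarrow> ('n \<Rightarrow> 'n set set) \<Rightarrow> 'n set \<Rightarrow> bool" where
  "quorum V S U \<longleftrightarrow> U \<noteq> {} \<and> U \<subseteq> V \<and> (\<forall>v\<in>U. \<exists>q\<in>S v. q \<subseteq> U)"

definition quorum_intersection :: "'n set \<Rightarrow> ('n \<Rightarrow> 'n set set) \<Rightarrow> bool" where
  "quorum_intersection V S \<longleftrightarrow>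
     (\<forall>U1 U2. quorum V S U1 \<and> quorum V S U2 \<longrightarrow> U1 \<inter> U2 \<noteq> {})"

text \<open>The projection of \<open>S\<close> to \<open>I\<close>, which is to be read over the universe \<open>I\<close>.\<close>

definition project :: "('n \<Rightarrow> 'n set set) \<Rightarrow> 'n set \<Rightarrow> 'n \<Rightarrow> 'n set set" where
  "project S I v = (\<lambda>q. q \<inter> I) ` S v"

text \<open>
  \<open>intact V S F\<close> is the set of intact servers when the faulty servers are those in \<open>F\<close>.
  The order is inclusion; the greatest set exists whenever \<open>V\<close> is finite and \<open>S\<close> is an FBQS
  with quorum intersection, because the admissible sets are then closed under union.
\<close>

definition intact :: "'n set \<Rightarrow> ('n \<Rightarrow> 'n set set) \<Rightarrow> 'n set \<Rightarrow> 'n set" where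
  "intact V S F =
     (GREATEST I. I \<subseteq> V \<and> I \<inter> F = {} \<and> (I \<noteq> {} \<longrightarrow> quorum V S I) \<and>
                  quorum_intersection I (project S I))"

definition blocking :: "('n \<Rightarrow> 'n set set) \<Rightarrow> 'n \<Rightarrow> 'n set \<Rightarrow> bool" where
  "blocking S v B \<longleftrightarrow> (\<forall>q\<in>S v. q \<inter> B \<noteq> {})"

definition induced_dqs :: "'n set \<Rightarrow> ('n \<Rightarrow> 'n set set) \<Rightarrow> 'n set set \<times> 'n set set" where
  "induced_dqs V S =
     ({U. quorum V S U},
      {B. B \<subseteq> V \<and> intact V S B \<noteq> {} \<and>
          (\<forall>B'. B' \<subseteq> V \<and> intact V S B' \<noteq> {} \<and> B \<subseteq> B' \<longrightarrow> B' = B)})"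


section \<open>Broadcast protocols\<close>

datatype 'a msg = BCAST 'a | ECHO 'a | READY 'a

datatype handler = Echo_on_Bcast | Ready_on_Echo | Ready_on_Ready | Deliver_on_Ready

text \<open>
  \<open>Receive v u m\<close>: node \<open>v\<close> receives \<open>m\<close> on its channel from \<open>u\<close>.
  \<open>Handle v h a\<close>: server \<open>v\<close> executes handler \<open>h\<close> for the value \<open>a\<close>; with
  \<open>h = Deliver_on_Ready\<close> this is the triggering of the deliver primitive.
\<close>

datatype ('n, 'a) event =
    Idle
  | Broadcast 'a
  | Receive 'n 'n "'a msg"
  | Handle 'n handler 'a

record ('n, 'a) local_state =
  received :: "('n \<times> 'a msg) set"
  echoed :: bool
  ready :: bool
  delivered :: bool

text \<open>
  \<open>(u, v, m) \<in> sent \<sigma>\<close>: the correct node \<open>u\<close> has sent \<open>m\<close> to \<open>v\<close>.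
  The field \<open>has_broadcast\<close> belongs to the sender.
\<close>

record ('n, 'a) config =
  local :: "'n \<Rightarrow> ('n, 'a) local_state"
  sent :: "('n \<times> 'n \<times> 'a msg) set"
  has_broadcast :: bool

definition initial_config :: "('n, 'a) config" where
  "initial_config =
     \<lparr>local = (\<lambda>_. \<lparr>received = {}, echoed = False, ready = False, delivered = False\<rparr>),
      sent = {}, has_broadcast = False\<rparr>"

text \<open>
  Guards and effects of the handlers. The quorums \<open>Q\<close> and, for each server, the family \<open>A v\<close> of
  sets whose \<open>READY\<close> messages make \<open>v\<close> ready are parameters: the two protocols differ in the
  latter only.
\<close>

fun enabled ::
  "'n set set \<Rightarrow> ('n \<Rightarrow> 'n set set) \<Rightarrow> 'n \<Rightarrow> 'n \<Rightarrow> handler \<Rightarrow> 'a \<Rightarrow> ('n, 'a) local_state \<Rightarrow> bool"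
where
  "enabled Q A c v Echo_on_Bcast a s \<longleftrightarrow>
     (c, BCAST a) \<in> received s \<and> \<not> echoed s"
| "enabled Q A c v Ready_on_Echo a s \<longleftrightarrow>
     (\<exists>U\<in>Q. \<forall>u\<in>U. (u, ECHO a) \<in> received s) \<and> \<not> ready s"
| "enabled Q A c v Ready_on_Ready a s \<longleftrightarrow>
     (\<exists>B\<in>A v. \<forall>u\<in>B. (u, READY a) \<in> received s) \<and> \<not> ready s"
| "enabled Q A c v Deliver_on_Ready a s \<longleftrightarrow>
     (\<exists>U\<in>Q. \<forall>u\<in>U. (u, READY a) \<in> received s) \<and> \<not> delivered s"

fun set_flag :: "handler \<Rightarrow> ('n, 'a) local_state \<Rightarrow> ('n, 'a) local_state" where
  "set_flag Echo_on_Bcast s = s\<lparr>echoed := True\<rparr>"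
| "set_flag Ready_on_Echo s = s\<lparr>ready := True\<rparr>"
| "set_flag Ready_on_Ready s = s\<lparr>ready := True\<rparr>"
| "set_flag Deliver_on_Ready s = s\<lparr>delivered := True\<rparr>"

fun sent_messages :: "handler \<Rightarrow> 'a \<Rightarrow> 'a msg set" where
  "sent_messages Echo_on_Bcast a = {ECHO a}"
| "sent_messages Ready_on_Echo a = {READY a}"
| "sent_messages Ready_on_Ready a = {READY a}"
| "sent_messages Deliver_on_Ready a = {}"

text \<open>
  \<open>F\<close> is the set of faulty nodes (clients and servers). Reception is unconstrained if one of the
  two endpoints is faulty, which subsumes every choice of messages a faulty node could send;
  hence there is no rule for sending by faulty nodes, and a faulty sender acts through
  \<open>Receive\<close> events only. A faulty server may moreover trigger deliver at will (rule \<open>faulty\<close>);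
  its local state is never consulted.
\<close>

inductive step ::
  "'n set \<Rightarrow> 'n set \<Rightarrow> 'n \<Rightarrow> 'n set \<Rightarrow> 'n set set \<Rightarrow> ('n \<Rightarrow> 'n set set) \<Rightarrow>
   ('n, 'a) config \<Rightarrow> ('n, 'a) event \<Rightarrow> ('n, 'a) config \<Rightarrow> bool"
  for C V c F Q A
where
  idle: "step C V c F Q A \<sigma> Idle \<sigma>"
| broadcast:
    "\<lbrakk>c \<notin> F; \<not> has_broadcast \<sigma>\<rbrakk> \<Longrightarrow>
     step C V c F Q A \<sigma> (Broadcast a)
       (\<sigma>\<lparr>has_broadcast := True, sent := sent \<sigma> \<union> {c} \<times> V \<times> {BCAST a}\<rparr>)"
| receive:
    "\<lbrakk>u \<in> C \<union> V; v \<in> C \<union> V; u \<notin> F \<and> v \<notin> F \<longrightarrow> (u, v, m) \<in> sent \<sigma>\<rbrakk> \<Longrightarrow>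
     step C V c F Q A \<sigma> (Receive v u m)
       (\<sigma>\<lparr>local := (local \<sigma>)(v := (local \<sigma> v)
            \<lparr>received := insert (u, m) (received (local \<sigma> v))\<rparr>)\<rparr>)"
| handle:
    "\<lbrakk>v \<in> V - F; enabled Q A c v h a (local \<sigma> v)\<rbrakk> \<Longrightarrow>
     step C V c F Q A \<sigma> (Handle v h a)
       (\<sigma>\<lparr>local := (local \<sigma>)(v := set_flag h (local \<sigma> v)),
          sent := sent \<sigma> \<union> {v} \<times> V \<times> sent_messages h a\<rparr>)"
| faulty:
    "v \<in> V \<inter> F \<Longrightarrow> step C V c F Q A \<sigma> (Handle v h a) \<sigma>"

text \<open>
  Executions are infinite sequences; \<open>Idle\<close> steps make room for those with only finitely many
  events. The last two conjuncts are reliability of the channels between correct nodes and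
  completeness.
\<close>

record ('n, 'a) execution =
  config_at :: "nat \<Rightarrow> ('n, 'a) config"
  event_at :: "nat \<Rightarrow> ('n, 'a) event"

definition is_execution ::
  "'n set \<Rightarrow> 'n set \<Rightarrow> 'n \<Rightarrow> 'n set \<Rightarrow> 'n set set \<Rightarrow> ('n \<Rightarrow> 'n set set) \<Rightarrow>
   ('n, 'a) execution \<Rightarrow> bool"
where
  "is_execution C V c F Q A \<rho> \<longleftrightarrow>
     config_at \<rho> 0 = initial_config \<and>
     (\<forall>i. step C V c F Q A (config_at \<rho> i) (event_at \<rho> i) (config_at \<rho> (Suc i))) \<and>
     (\<forall>i u v m. (u, v, m) \<in> sent (config_at \<rho> i) \<and> u \<notin> F \<and> v \<notin> F \<longrightarrow>
        (\<exists>j. event_at \<rho> j = Receive v u m)) \<and>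
     (\<forall>v\<in>V - F. \<forall>h a i.
        (\<forall>j\<ge>i. enabled Q A c v h a (local (config_at \<rho> j) v)) \<longrightarrow>
        (\<exists>j\<ge>i. event_at \<rho> j = Handle v h a))"

definition bracha_execution ::
  "'n set \<Rightarrow> 'n set \<Rightarrow> 'n \<Rightarrow> 'n set \<Rightarrow> 'n set set \<times> 'n set set \<Rightarrow> ('n, 'a) execution \<Rightarrow> bool"
where
  "bracha_execution C V c F D \<rho> \<longleftrightarrow>
     is_execution C V c F (fst D)
       (\<lambda>v. {B. B \<noteq> {} \<and> B \<subseteq> V \<and> (\<forall>B'\<in>snd D. \<not> B \<subseteq> B')}) \<rho>"

definition relaxed_stellar_execution ::
  "'n set \<Rightarrow> 'n set \<Rightarrow> 'n \<Rightarrow> 'n set \<Rightarrow> ('n \<Rightarrow> 'n set set) \<Rightarrow> ('n, 'a) execution \<Rightarrow> bool"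
where
  "relaxed_stellar_execution C V c F S \<rho> \<longleftrightarrow>
     is_execution C V c F {U. quorum V S U}
       (\<lambda>v. {B. B \<noteq> {} \<and> B \<subseteq> V \<and> blocking S v B}) \<rho>"


section \<open>Histories\<close>

datatype ('n, 'a) history_event = First_Bcast 'n 'a | Deliver 'n 'a

definition history :: "'n set \<Rightarrow> 'n \<Rightarrow> ('n, 'a) execution \<Rightarrow> ('n, 'a) history_event set" where
  "history V c \<rho> =
     {First_Bcast v a | v a. v \<in> V \<and>
        (\<exists>i. event_at \<rho> i = Receive v c (BCAST a) \<and>
             (\<forall>j<i. \<forall>b. event_at \<rho> j \<noteq> Receive v c (BCAST b)))} \<union>
     {Deliver v a | v a. v \<in> V \<and> (\<exists>i. event_at \<rho> i = Handle v Deliver_on_Ready a)}"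

end

theory Submission
  imports Defs
begin

text \<open>
  In both protocols the deliveries at correct servers are governed by the echoes alone. Two quorums
  always share an intact server. The first intact server to become ready has seen a quorum of echoes
  for its value, and the sets of \<open>READY\<close> messages that make an intact server ready contain an
  intact server. Hence if some correct server delivers \<open>a\<close>, then the correct members of some quorum
  have echoed \<open>a\<close>, and all correct servers deliver \<open>a\<close> and nothing else. If no correct server
  delivers, then no quorum of correct servers has echoed a common value.

  Conversely, given the receptions of \<open>BCAST\<close> and the echoes of such an execution, either protocol can
  be run as follows. If there was a delivery, the faulty members of the quorum echo \<open>a\<close> to everybody,
  whereupon all correct servers become ready and deliver \<open>a\<close>. If there was none, the faulty servers
  send nothing and no further handler of a correct server is ever enabled. The handler in which
  the protocols differ is not executed at all. Deliveries by faulty servers may be infinitely many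
  and form the tail of the new execution.
\<close>

section \<open>Intact servers\<close>

text \<open>The predicate under \<open>GREATEST\<close> in \<open>intact\<close>, named so that its
  closure under union can be stated.\<close>

definition admissible :: "'n set \<Rightarrow> ('n \<Rightarrow> 'n set set) \<Rightarrow> 'n set \<Rightarrow> 'n set \<Rightarrow> bool" where
  "admissible V S B I \<longleftrightarrow>
     I \<subseteq> V \<and> I \<inter> B = {} \<and> (I \<noteq> {} \<longrightarrow> quorum V S I) \<and> quorum_intersection I (project S I)"

section \<open>Quorums of a system and of its projections\<close>

lemma quorum_Un: "quorum V S U1 \<Longrightarrow> quorum V S U2 \<Longrightarrow> quorum V S (U1 \<union> U2)"
  unfolding quorum_def by (metis Un_iff Un_least Un_empty le_supI1 le_supI2)

lemma quorum_project_iff: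
  "quorum I (project S I) U \<longleftrightarrow> U \<noteq> {} \<and> U \<subseteq> I \<and> (\<forall>v\<in>U. \<exists>q\<in>S v. q \<inter> I \<subseteq> U)"
  by (simp add: quorum_def project_def)

lemma quorum_slice: "quorum V S U \<Longrightarrow> v \<in> U \<Longrightarrow> \<exists>q\<in>S v. q \<subseteq> U"
  by (simp add: quorum_def)

lemma quorum_intersectionD:
  "quorum_intersection V S \<Longrightarrow> quorum V S U1 \<Longrightarrow> quorum V S U2 \<Longrightarrow> U1 \<inter> U2 \<noteq> {}"
  by (simp add: quorum_intersection_def)

lemma quorum_project_mono:
  assumes U: "quorum J (project S J) U" and "I \<subseteq> J" and "U \<inter> I \<noteq> {}"
  shows "quorum I (project S I) (U \<inter> I)"
  unfolding quorum_project_iff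
proof (intro conjI ballI)
  fix v assume "v \<in> U \<inter> I"
  then obtain q where "q \<in> S v" "q \<inter> J \<subseteq> U"
    using U[unfolded quorum_project_iff] by blast
  then show "\<exists>q\<in>S v. q \<inter> I \<subseteq> U \<inter> I"
    using \<open>I \<subseteq> J\<close> by (intro bexI[of _ q]) auto
qed (use \<open>U \<inter> I \<noteq> {}\<close> in auto)

lemma quorum_project:
  assumes "quorum V S U" and "U \<inter> I \<noteq> {}"
  shows "quorum I (project S I) (U \<inter> I)"
  unfolding quorum_project_iff
proof (intro conjI ballI)
  fix v assume "v \<in> U \<inter> I"
  then obtain q where "q \<in> S v" "q \<subseteq> U"
    using quorum_slice[OF assms(1), of v] by auto
  then show "\<exists>q\<in>S v. q \<inter> I \<subseteq> U \<inter> I"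
    by (intro bexI[of _ q]) auto
qed (use assms(2) in auto)

section \<open>Existence of the greatest admissible set\<close>

text \<open>Every quorum of the projection to \<open>I1 \<union> I2\<close> meets \<open>I1\<close>:
  otherwise it would lie in \<open>I2\<close> and be disjoint from \<open>I1 \<inter> I2\<close>,
  which is a quorum of the projection to \<open>I2\<close> because the quorums \<open>I1\<close> and
  \<open>I2\<close> intersect. Two such quorums therefore restrict to quorums of the projection to
  \<open>I1\<close> and meet there.\<close>

lemma admissible_Un:
  assumes qi: "quorum_intersection V S"
    and a1: "admissible V S B I1" and a2: "admissible V S B I2"
  shows "admissible V S B (I1 \<union> I2)"
proof (cases "I1 = {} \<or> I2 = {}")
  case True
  then show ?thesis using a1 a2 by auto
next
  case False
  then have q1: "quorum V S I1" and q2: "quorum V S I2"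
    using a1 a2 by (auto simp: admissible_def)
  have meets: "U \<inter> I1 \<noteq> {}" if U: "quorum (I1 \<union> I2) (project S (I1 \<union> I2)) U" for U
  proof
    assume disj: "U \<inter> I1 = {}"
    then have "U \<inter> I2 \<noteq> {}" using U unfolding quorum_def by blast
    then have "quorum I2 (project S I2) (U \<inter> I2)"
      using quorum_project_mono[OF U] by blast
    moreover have "quorum I2 (project S I2) (I1 \<inter> I2)"
      using quorum_project[OF q1] quorum_intersectionD[OF qi q1 q2] by simp
    ultimately have "(U \<inter> I2) \<inter> (I1 \<inter> I2) \<noteq> {}"
      using a2 unfolding admissible_def quorum_intersection_def by blast
    then show False using disj by blast
  qed
  have "quorum_intersection (I1 \<union> I2) (project S (I1 \<union> I2))"
    unfolding quorum_intersection_def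
  proof (intro allI impI, elim conjE)
    fix U1 U2
    assume "quorum (I1 \<union> I2) (project S (I1 \<union> I2)) U1"
      and "quorum (I1 \<union> I2) (project S (I1 \<union> I2)) U2"
    then have "quorum I1 (project S I1) (U1 \<inter> I1)" "quorum I1 (project S I1) (U2 \<inter> I1)"
      using quorum_project_mono meets by (metis Un_upper1)+
    then have "(U1 \<inter> I1) \<inter> (U2 \<inter> I1) \<noteq> {}"
      using a1 unfolding admissible_def quorum_intersection_def by blast
    then show "U1 \<inter> U2 \<noteq> {}" by blast
  qed
  then show ?thesis
    using a1 a2 quorum_Un[OF q1 q2] unfolding admissible_def by blast
qed

lemma admissible_empty: "admissible V S B {}"
  unfolding admissible_def quorum_intersection_def quorum_def by blast

text \<open>Finiteness of \<open>V\<close> extends closure under binary unions to the union of all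
  admissible sets, which is then the greatest one.\<close>

lemma intact_greatest:
  assumes "finite V" and qi: "quorum_intersection V S"
  shows "admissible V S B (intact V S B)"
    and "admissible V S B I \<Longrightarrow> I \<subseteq> intact V S B"
proof -
  let ?M = "{I. admissible V S B I}"
  have fin: "finite ?M"
    by (rule finite_subset[of _ "Pow V"]) (auto simp: admissible_def \<open>finite V\<close>)
  have un: "admissible V S B (\<Union>M)" if "finite M" "M \<subseteq> ?M" for M
    using that by (induction M) (auto simp: admissible_empty admissible_Un[OF qi])
  have "intact V S B = \<Union>?M"
    unfolding intact_def
  proof (rule Greatest_equality)
    show "\<Union>?M \<subseteq> V \<and> \<Union>?M \<inter> B = {} \<and> (\<Union>?M \<noteq> {} \<longrightarrow> quorum V S (\<Union>?M)) \<and>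
            quorum_intersection (\<Union>?M) (project S (\<Union>?M))"
      using un[OF fin order_refl] unfolding admissible_def .
  next
    fix I
    assume "I \<subseteq> V \<and> I \<inter> B = {} \<and> (I \<noteq> {} \<longrightarrow> quorum V S I) \<and>
              quorum_intersection I (project S I)"
    then have "I \<in> ?M" unfolding admissible_def by simp
    then show "I \<le> \<Union>?M" by blast
  qed
  then show "admissible V S B (intact V S B)"
    and "admissible V S B I \<Longrightarrow> I \<subseteq> intact V S B"
    using un[OF fin order_refl] by auto
qed

section \<open>Intersection and blocking with respect to the intact set\<close>

lemma
  assumes "finite V" and "quorum_intersection V S" and "intact V S B \<noteq> {}"
  shows intact_quorum: "quorum V S (intact V S B)"
    and intact_disjoint: "intact V S B \<inter> B = {}"
    and intact_quorum_intersection: "quorum_intersection (intact V S B) (project S (intact V S B))"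
  using intact_greatest(1)[OF assms(1,2), of B] assms(3) unfolding admissible_def by blast+

lemma quorum_project_intact:
  assumes "finite V" and "quorum_intersection V S" and "intact V S B \<noteq> {}" and "quorum V S U"
  shows "quorum (intact V S B) (project S (intact V S B)) (U \<inter> intact V S B)"
  using assms by (intro quorum_project quorum_intersectionD[of V S] intact_quorum)

text \<open>Both quorums restrict to quorums of the projection to the intact set, which has quorum
  intersection.\<close>

lemma quorums_meet_in_intact:
  assumes "finite V" and "quorum_intersection V S" and "intact V S B \<noteq> {}"
    and "quorum V S U1" and "quorum V S U2"
  shows "U1 \<inter> U2 \<inter> intact V S B \<noteq> {}"
  using quorum_intersectionD[OF intact_quorum_intersection[OF assms(1-3)]
      quorum_project_intact[OF assms(1-3) assms(4)] quorum_project_intact[OF assms(1-3) assms(5)]]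
  by (simp add: Int_ac)

text \<open>The intact set is a quorum, so it contains a slice of each of its members, and a
  blocking set meets that slice.\<close>

lemma blocking_meets_intact:
  assumes "finite V" and "quorum_intersection V S" and v: "v \<in> intact V S B'"
    and "blocking S v B"
  shows "B \<inter> intact V S B' \<noteq> {}"
proof -
  obtain q where "q \<in> S v" "q \<subseteq> intact V S B'"
    using quorum_slice[OF intact_quorum[OF assms(1,2)] v] v by auto
  then show ?thesis using assms(4) unfolding blocking_def by fastforce
qed

text \<open>
  If \<open>W\<close> blocked no server of \<open>I - W\<close>, where \<open>I\<close> is the set of intact servers, then \<open>I - W\<close>
  would be a quorum of the projection to \<open>I\<close>, disjoint from \<open>U \<inter> I\<close>.
\<close>

lemma blocking_cascade:
  assumes fin: "finite V" and qi: "quorum_intersection V S"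
    and U: "quorum V S U" "U \<inter> intact V S B' \<subseteq> W" and W: "W \<subset> intact V S B'"
  shows "\<exists>v\<in>intact V S B' - W. blocking S v W"
proof (rule ccontr)
  let ?I = "intact V S B'"
  assume "\<not> (\<exists>v\<in>?I - W. blocking S v W)"
  then have no: "\<forall>v\<in>?I - W. \<not> blocking S v W" by simp
  have ne: "?I \<noteq> {}" using W by blast
  have "\<exists>q\<in>S v. q \<inter> ?I \<subseteq> ?I - W" if v: "v \<in> ?I - W" for v
  proof -
    obtain q where "q \<in> S v" "q \<inter> W = {}"
      using bspec[OF no v] by (auto simp: blocking_def)
    then show ?thesis by (intro bexI[of _ q]) auto
  qed
  then have "quorum ?I (project S ?I) (?I - W)"
    using W unfolding quorum_project_iff by auto
  from quorum_intersectionD[OF intact_quorum_intersection[OF fin qi ne] this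
      quorum_project_intact[OF fin qi ne U(1)]]
  obtain x where "x \<in> ?I - W" "x \<in> U \<inter> ?I" by blast
  then show False using subsetD[OF U(2), of x] by simp
qed

section \<open>Fail-prone sets of the induced system\<close>

text \<open>When everything outside the intact set fails, the intact set is still admissible. Its
  complement is thus among the sets that leave some server intact, and by finiteness it lies below a
  maximal one.\<close>

lemma induced_fail_prone_superset:
  assumes fin: "finite V" and qi: "quorum_intersection V S" and ne: "intact V S B \<noteq> {}"
  shows "\<exists>B'\<in>snd (induced_dqs V S). V - intact V S B \<subseteq> B'"
proof -
  let ?I = "intact V S B"
  have "admissible V S (V - ?I) ?I"
    using intact_greatest(1)[OF fin qi, of B] unfolding admissible_def by simp
  then have "intact V S (V - ?I) \<noteq> {}"
    using intact_greatest(2)[OF fin qi] ne by blast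
  then have mem: "V - ?I \<in> {B. B \<subseteq> V \<and> intact V S B \<noteq> {}}" by blast
  have "finite {B. B \<subseteq> V \<and> intact V S B \<noteq> {}}"
    using fin by simp
  from finite_has_maximal2[OF this mem] obtain M where
    "V - ?I \<subseteq> M" "M \<subseteq> V" "intact V S M \<noteq> {}"
    "\<And>M'. M' \<subseteq> V \<Longrightarrow> intact V S M' \<noteq> {} \<Longrightarrow> M \<subseteq> M' \<Longrightarrow> M = M'"
    by (metis (mono_tags, lifting) mem_Collect_eq)
  then have "M \<in> snd (induced_dqs V S)"
    by (auto simp: induced_dqs_def)
  then show ?thesis
    using \<open>V - ?I \<subseteq> M\<close> by (rule bexI[rotated])
qed

lemma induced_meets_intact:
  assumes "finite V" and "quorum_intersection V S" and "intact V S B' \<noteq> {}"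
    and "B \<subseteq> V" and "\<And>B'. B' \<in> snd (induced_dqs V S) \<Longrightarrow> \<not> B \<subseteq> B'"
  shows "B \<inter> intact V S B' \<noteq> {}"
  using induced_fail_prone_superset[OF assms(1-3)] assms(4,5) by blast

text \<open>\<open>U1\<close> and \<open>U2\<close> share a server that is intact when
  \<open>B\<close> fails, and such a server is outside \<open>B\<close>.\<close>

lemma induced_consistency:
  assumes "finite V" and "quorum_intersection V S"
    and "quorum V S U1" and "quorum V S U2" and B: "B \<in> snd (induced_dqs V S)"
  shows "\<not> U1 \<inter> U2 \<subseteq> B"
proof -
  have ne: "intact V S B \<noteq> {}" using B unfolding induced_dqs_def by simp
  then show ?thesis
    using quorums_meet_in_intact[OF assms(1,2) ne assms(3,4)]
      intact_disjoint[OF assms(1,2) ne] by blast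
qed

section \<open>Consequences of the protocol\<close>

text \<open>
  What the analysis needs of the sets \<open>A v\<close> whose \<open>READY\<close> messages make \<open>v\<close> ready: at intact
  servers they contain an intact server, and the intact members of a quorum suffice to make all
  intact servers ready, one after the other.
\<close>

locale ready_families =
  fixes C V :: "'n set" and c :: 'n and F I :: "'n set" and \<Q> :: "'n set set"
    and A :: "'n \<Rightarrow> 'n set set"
  assumes finite_V: "finite V"
    and clients: "C \<inter> V = {}" "c \<in> C"
    and quorum_subset: "U \<in> \<Q> \<Longrightarrow> U \<subseteq> V"
    and I_quorum: "I \<in> \<Q>"
    and I_correct: "I \<inter> F = {}"
    and quorums_meet: "U \<in> \<Q> \<Longrightarrow> U' \<in> \<Q> \<Longrightarrow> U \<inter> U' \<inter> I \<noteq> {}"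
    and ready_meets: "v \<in> I \<Longrightarrow> B \<in> A v \<Longrightarrow> B \<inter> I \<noteq> {}"
    and ready_cascade: "U \<in> \<Q> \<Longrightarrow> U \<inter> I \<subseteq> W \<Longrightarrow> W \<subset> I \<Longrightarrow> \<exists>v\<in>I - W. \<exists>B\<in>A v. B \<subseteq> W"
begin

lemma I_subset: "I \<subseteq> V - F"
  using quorum_subset[OF I_quorum] I_correct by auto

lemma I_nonempty: "I \<noteq> {}"
  using quorums_meet[OF I_quorum I_quorum] by auto

end

locale protocol_execution = ready_families C V c F I \<Q> A
  for C V :: "'n set" and c :: 'n and F I :: "'n set" and \<Q> :: "'n set set"
    and A :: "'n \<Rightarrow> 'n set set" +
  fixes \<rho> :: "('n, 'a) execution"
  assumes execution: "is_execution C V c F \<Q> A \<rho>"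
begin

abbreviation ev :: "nat \<Rightarrow> ('n, 'a) event" where "ev \<equiv> event_at \<rho>"
abbreviation snt :: "nat \<Rightarrow> ('n \<times> 'n \<times> 'a msg) set" where "snt i \<equiv> sent (config_at \<rho> i)"
abbreviation st :: "nat \<Rightarrow> 'n \<Rightarrow> ('n, 'a) local_state" where "st i v \<equiv> local (config_at \<rho> i) v"

section \<open>Steps, channels and flags along an execution\<close>

lemma config_0: "config_at \<rho> 0 = initial_config"
  using execution by (simp add: is_execution_def)

lemma step_at: "step C V c F \<Q> A (config_at \<rho> i) (ev i) (config_at \<rho> (Suc i))"
  using execution by (simp add: is_execution_def)

lemma reliable: "(u, v, m) \<in> snt i \<Longrightarrow> u \<notin> F \<Longrightarrow> v \<notin> F \<Longrightarrow> \<exists>j. ev j = Receive v u m"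
  using execution by (simp add: is_execution_def)

lemma complete:
  assumes "v \<in> V - F" and "\<And>j. j \<ge> i \<Longrightarrow> enabled \<Q> A c v h a (st j v)"
  shows "\<exists>j\<ge>i. ev j = Handle v h a"
  using execution assms by (simp add: is_execution_def)

lemma mono_Suc:
  "snt i \<subseteq> snt (Suc i)"
  "received (st i v) \<subseteq> received (st (Suc i) v)"
  "echoed (st i v) \<longrightarrow> echoed (st (Suc i) v)"
  "ready (st i v) \<longrightarrow> ready (st (Suc i) v)"
  "delivered (st i v) \<longrightarrow> delivered (st (Suc i) v)"
proof -
  have "snt i \<subseteq> snt (Suc i) \<and> received (st i v) \<subseteq> received (st (Suc i) v) \<and>
    (echoed (st i v) \<longrightarrow> echoed (st (Suc i) v)) \<and> (ready (st i v) \<longrightarrow> ready (st (Suc i) v)) \<and>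
    (delivered (st i v) \<longrightarrow> delivered (st (Suc i) v))"
    using step_at[of i]
  proof cases
    case (handle v' h a)
    then show ?thesis by (cases h) auto
  qed auto
  then show "snt i \<subseteq> snt (Suc i)"
    "received (st i v) \<subseteq> received (st (Suc i) v)"
    "echoed (st i v) \<longrightarrow> echoed (st (Suc i) v)"
    "ready (st i v) \<longrightarrow> ready (st (Suc i) v)"
    "delivered (st i v) \<longrightarrow> delivered (st (Suc i) v)" by blast+
qed

lemma sent_mono: "i \<le> j \<Longrightarrow> x \<in> snt i \<Longrightarrow> x \<in> snt j"
  using lift_Suc_mono_le[of snt, OF mono_Suc(1)] by blast

lemma received_mono: "i \<le> j \<Longrightarrow> x \<in> received (st i v) \<Longrightarrow> x \<in> received (st j v)"
  using lift_Suc_mono_le[of "\<lambda>i. received (st i v)", OF mono_Suc(2)] by blast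

lemma flag_mono:
  assumes "i \<le> j"
  shows "echoed (st i v) \<Longrightarrow> echoed (st j v)" "ready (st i v) \<Longrightarrow> ready (st j v)"
    "delivered (st i v) \<Longrightarrow> delivered (st j v)"
  using assms by (induction rule: dec_induct) (use mono_Suc in blast)+

lemma receive_event:
  assumes "ev i = Receive v u m"
  shows "u \<notin> F \<Longrightarrow> v \<notin> F \<Longrightarrow> (u, v, m) \<in> snt i"
    "(u, m) \<in> received (st (Suc i) v)"
  using step_at[of i] assms by (cases, auto)+

lemma
  assumes "ev i = Handle v h a" and "v \<in> V - F"
  shows handle_enabled: "enabled \<Q> A c v h a (st i v)"
    and handle_local: "st (Suc i) v = set_flag h (st i v)"
    and handle_sent: "snt (Suc i) = snt i \<union> {v} \<times> V \<times> sent_messages h a"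
  using step_at[of i] assms by (cases, auto)+

lemma received_imp_event:
  "(u, m) \<in> received (st i v) \<Longrightarrow> \<exists>j<i. ev j = Receive v u m"
proof (induction i)
  case 0
  then show ?case by (simp add: config_0 initial_config_def)
next
  case (Suc i)
  have "(u, m) \<in> received (st i v) \<or> ev i = Receive v u m"
    using step_at[of i]
  proof cases
    case (handle v' h a)
    then show ?thesis using Suc.prems by (cases h) (auto split: if_splits)
  qed (use Suc.prems in \<open>auto split: if_splits\<close>)
  then show ?case using Suc.IH less_Suc_eq by blast
qed

lemma received_imp_sent:
  assumes "(u, m) \<in> received (st i v)" and "u \<notin> F" and "v \<notin> F"
  shows "(u, v, m) \<in> snt i"
  using received_imp_event[OF assms(1)] receive_event(1) assms(2,3) sent_mono less_imp_le by blast

lemma sent_imp_received: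
  assumes "(u, v, m) \<in> snt i" and "u \<notin> F" and "v \<notin> F"
  shows "\<exists>j. (u, m) \<in> received (st j v)"
  using reliable[OF assms] receive_event(2) by blast

text \<open>Finiteness supplies a common time from which on the guard of a handler sees the whole
  set; completeness speaks only of handlers that stay enabled.\<close>

lemma eventually_received_all:
  assumes "finite U" and "\<And>u. u \<in> U \<Longrightarrow> \<exists>j. (u, m) \<in> received (st j v)"
  shows "\<exists>k. \<forall>j\<ge>k. \<forall>u\<in>U. (u, m) \<in> received (st j v)"
  using assms
proof (induction U)
  case (insert x U)
  obtain k where "\<forall>j\<ge>k. \<forall>u\<in>U. (u, m) \<in> received (st j v)"
    using insert.IH insert.prems by blast
  moreover obtain k' where "(x, m) \<in> received (st k' v)"
    using insert.prems by blast
  ultimately have "\<forall>j\<ge>max k k'. \<forall>u\<in>insert x U. (u, m) \<in> received (st j v)"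
    using received_mono[of k' _ "(x, m)" v] by auto
  then show ?case by blast
qed auto

text \<open>Only \<open>Broadcast\<close> and guarded \<open>Handle\<close> steps enlarge
  \<open>sent\<close>, and both are reserved for correct nodes. Hence membership in
  \<open>sent\<close> certifies a correct origin.\<close>

lemma sent_imp_event:
  assumes "(u, w, m) \<in> snt i"
  shows "(u = c \<and> c \<notin> F \<and> (\<exists>a. m = BCAST a \<and> (\<exists>j<i. ev j = Broadcast a))) \<or>
    (u \<in> V - F \<and> (\<exists>j<i. \<exists>h a. ev j = Handle u h a \<and> m \<in> sent_messages h a))"
  using assms
proof (induction i)
  case 0
  then show ?case by (simp add: config_0 initial_config_def)
next
  case (Suc i)
  show ?case
  proof (cases "(u, w, m) \<in> snt i")
    case True
    then show ?thesis using Suc.IH less_Suc_eq by blast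
  next
    case False
    show ?thesis using step_at[of i]
    proof cases
      case (broadcast a)
      then show ?thesis using False Suc.prems by auto
    next
      case (handle v h a)
      then show ?thesis using False Suc.prems by auto
    qed (use False Suc.prems in auto)
  qed
qed

lemma sent_messages_iff:
  "BCAST a \<notin> sent_messages h b"
  "ECHO a \<in> sent_messages h b \<longleftrightarrow> h = Echo_on_Bcast \<and> b = a"
  "READY a \<in> sent_messages h b \<longleftrightarrow> (h = Ready_on_Echo \<or> h = Ready_on_Ready) \<and> b = a"
  by (cases h; auto)+

text \<open>Restricted to correct servers, like the two definitions that follow, since the rule
  \<open>faulty\<close> lets faulty servers show \<open>Handle\<close> events without any
  guard.\<close>

definition echoes :: "'n \<Rightarrow> 'a \<Rightarrow> bool" where
  "echoes v a \<longleftrightarrow> v \<in> V - F \<and> (\<exists>i. ev i = Handle v Echo_on_Bcast a)"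

definition readies :: "'n \<Rightarrow> 'a \<Rightarrow> bool" where
  "readies v a \<longleftrightarrow> v \<in> V - F \<and>
     (\<exists>i. ev i = Handle v Ready_on_Echo a \<or> ev i = Handle v Ready_on_Ready a)"

definition delivers :: "'n \<Rightarrow> 'a \<Rightarrow> bool" where
  "delivers v a \<longleftrightarrow> v \<in> V - F \<and> (\<exists>i. ev i = Handle v Deliver_on_Ready a)"

lemma sent_echo_imp: "(u, w, ECHO a) \<in> snt i \<Longrightarrow> u \<in> V - F \<and> (\<exists>j<i. ev j = Handle u Echo_on_Bcast a)"
  by (drule sent_imp_event) (auto simp: sent_messages_iff)

lemma sent_ready_imp:
  "(u, w, READY a) \<in> snt i \<Longrightarrow> u \<in> V - F \<and>
     (\<exists>j<i. ev j = Handle u Ready_on_Echo a \<or> ev j = Handle u Ready_on_Ready a)"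
  by (drule sent_imp_event) (auto simp: sent_messages_iff)

lemma echoes_imp_sent: "echoes v a \<Longrightarrow> w \<in> V \<Longrightarrow> \<exists>i. (v, w, ECHO a) \<in> snt i"
  unfolding echoes_def using handle_sent[of _ v Echo_on_Bcast a] by fastforce

lemma readies_imp_sent: "readies v a \<Longrightarrow> w \<in> V \<Longrightarrow> \<exists>i. (v, w, READY a) \<in> snt i"
  unfolding readies_def
  using handle_sent[of _ v Ready_on_Echo a] handle_sent[of _ v Ready_on_Ready a] by fastforce

text \<open>A flag is raised only by its own handlers. The contrapositive feeds completeness:
  without such an event the flag stays false and the guard is not disabled by it.\<close>

lemma flag_imp_event:
  assumes "v \<in> V - F"
  shows "echoed (st i v) \<Longrightarrow> \<exists>a. echoes v a" "ready (st i v) \<Longrightarrow> \<exists>a. readies v a"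
    "delivered (st i v) \<Longrightarrow> \<exists>a. delivers v a"
proof (induction i)
  case (Suc i)
  have "(echoed (st (Suc i) v) \<longrightarrow> echoed (st i v) \<or> (\<exists>a. echoes v a)) \<and>
    (ready (st (Suc i) v) \<longrightarrow> ready (st i v) \<or> (\<exists>a. readies v a)) \<and>
    (delivered (st (Suc i) v) \<longrightarrow> delivered (st i v) \<or> (\<exists>a. delivers v a))"
    using step_at[of i]
  proof cases
    case (handle v' h a)
    then show ?thesis
      by (cases h) (auto simp: echoes_def readies_def delivers_def split: if_splits)
  qed (auto split: if_splits)
  with Suc show "echoed (st (Suc i) v) \<Longrightarrow> \<exists>a. echoes v a"
    "ready (st (Suc i) v) \<Longrightarrow> \<exists>a. readies v a"
    "delivered (st (Suc i) v) \<Longrightarrow> \<exists>a. delivers v a" by blast+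
qed (simp_all add: config_0 initial_config_def)

text \<open>The flag \<open>echoed\<close> is false before and true ever after an echo, so two
  echoes of one server take place at the same index.\<close>

lemma echoes_unique:
  assumes "echoes v a" and "echoes v b"
  shows "a = b"
proof -
  from assms obtain i j where ij: "ev i = Handle v Echo_on_Bcast a" "ev j = Handle v Echo_on_Bcast b"
    and v: "v \<in> V - F" unfolding echoes_def by blast
  have "\<not> echoed (st i v)" "\<not> echoed (st j v)" "echoed (st (Suc i) v)" "echoed (st (Suc j) v)"
    using handle_enabled[OF ij(1) v] handle_local[OF ij(1) v]
      handle_enabled[OF ij(2) v] handle_local[OF ij(2) v] by simp_all
  then have "i = j"
    using flag_mono(1)[of "Suc i" j v] flag_mono(1)[of "Suc j" i v] by (metis linorder_neqE_nat Suc_leI)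
  then show ?thesis using ij by simp
qed

lemma echoes_imp_bcast: "echoes v a \<Longrightarrow> \<exists>i. ev i = Receive v c (BCAST a)"
  unfolding echoes_def using handle_enabled[of _ v Echo_on_Bcast a] received_imp_event by fastforce

text \<open>A server that never echoed would keep the handler enabled, against completeness. The
  echoed value may differ from \<open>a\<close>, as a faulty sender can send several values.\<close>

lemma bcast_imp_echoes:
  assumes v: "v \<in> V - F" and "ev i = Receive v c (BCAST a)"
  shows "\<exists>b. echoes v b"
proof (rule ccontr)
  assume no: "\<nexists>b. echoes v b"
  have "enabled \<Q> A c v Echo_on_Bcast a (st j v)" if "j \<ge> Suc i" for j
    using flag_imp_event(1)[OF v] no receive_event(2)[OF assms(2)] received_mono[OF that] by auto
  then show False
    using complete[OF v] no v unfolding echoes_def by blast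
qed

section \<open>Agreement on a single value\<close>

text \<open>Induction on time: \<open>Ready_on_Echo\<close> exhibits a quorum at once, and the set
  used by \<open>Ready_on_Ready\<close> contains an intact server whose \<open>READY\<close> was
  sent earlier. Faulty members of the quorum are left out because what is received from them proves
  nothing.\<close>

lemma readies_intact_imp_echo_quorum_aux:
  "(u, w, READY a) \<in> snt i \<Longrightarrow> u \<in> I \<Longrightarrow> \<exists>U\<in>\<Q>. \<forall>x\<in>U - F. echoes x a"
proof (induction i arbitrary: u w rule: less_induct)
  case (less i)
  obtain j where j: "j < i" "ev j = Handle u Ready_on_Echo a \<or> ev j = Handle u Ready_on_Ready a"
    using sent_ready_imp[OF less.prems(1)] by blast
  have u: "u \<in> V - F" using I_subset less.prems(2) by blast
  from j(2) show ?case
  proof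
    assume "ev j = Handle u Ready_on_Echo a"
    from handle_enabled[OF this u] obtain U where
      U: "U \<in> \<Q>" "\<forall>x\<in>U. (x, ECHO a) \<in> received (st j u)" by auto
    then have "\<forall>x\<in>U - F. echoes x a"
      using received_imp_sent[of _ _ j u] sent_echo_imp[of _ u a j] u
      unfolding echoes_def by blast
    with U(1) show ?thesis by blast
  next
    assume "ev j = Handle u Ready_on_Ready a"
    from handle_enabled[OF this u] obtain B where
      B: "B \<in> A u" "\<forall>x\<in>B. (x, READY a) \<in> received (st j u)" by auto
    obtain y where y: "y \<in> B" "y \<in> I" using ready_meets[OF less.prems(2) B(1)] by blast
    then have "(y, u, READY a) \<in> snt j"
      using received_imp_sent[of y _ j u] B(2) u I_subset by blast
    then show ?thesis using less.IH[OF j(1)] y(2) by blast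
  qed
qed

lemma readies_intact_imp_echo_quorum:
  assumes "readies u a" and "u \<in> I"
  shows "\<exists>U\<in>\<Q>. \<forall>x\<in>U - F. echoes x a"
proof -
  have "u \<in> V" using assms(2) I_subset by blast
  then show ?thesis
    using readies_imp_sent[OF assms(1)] readies_intact_imp_echo_quorum_aux assms(2) by blast
qed

text \<open>The two echo quorums share an intact server, which echoes only one value.\<close>

lemma readies_intact_unique:
  assumes "readies u a" "u \<in> I" and "readies w b" "w \<in> I"
  shows "a = b"
proof -
  obtain U W where "U \<in> \<Q>" "W \<in> \<Q>" and e: "\<forall>x\<in>U - F. echoes x a" "\<forall>x\<in>W - F. echoes x b"
    using readies_intact_imp_echo_quorum assms by metis
  then obtain x where "x \<in> U" "x \<in> W" "x \<in> I" using quorums_meet by blast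
  then show ?thesis using e echoes_unique I_correct by blast
qed

lemma delivers_imp_ready_quorum:
  assumes "delivers v a"
  shows "\<exists>U\<in>\<Q>. \<forall>u\<in>U - F. readies u a"
proof -
  from assms obtain i where v: "v \<in> V - F" and i: "ev i = Handle v Deliver_on_Ready a"
    unfolding delivers_def by blast
  from handle_enabled[OF i v] obtain U where
    "U \<in> \<Q>" "\<forall>x\<in>U. (x, READY a) \<in> received (st i v)" by auto
  moreover from this have "\<forall>x\<in>U - F. readies x a"
    using received_imp_sent[of _ _ i v] sent_ready_imp[of _ v a i] v
    unfolding readies_def by blast
  ultimately show ?thesis by blast
qed

lemma delivers_imp_intact_readies:
  assumes "delivers v a"
  shows "\<exists>u\<in>I. readies u a"
proof -
  obtain U where "U \<in> \<Q>" "\<forall>u\<in>U - F. readies u a"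
    using delivers_imp_ready_quorum[OF assms] by blast
  moreover then obtain x where "x \<in> U" "x \<in> I" using quorums_meet by blast
  ultimately show ?thesis using I_correct by blast
qed

lemma delivers_imp_echo_quorum: "delivers v a \<Longrightarrow> \<exists>U\<in>\<Q>. \<forall>x\<in>U - F. echoes x a"
  using delivers_imp_intact_readies readies_intact_imp_echo_quorum by blast

lemma delivers_agree: "delivers v a \<Longrightarrow> delivers w b \<Longrightarrow> a = b"
  using delivers_imp_intact_readies readies_intact_unique by metis

text \<open>The value \<open>b\<close> is left open because the server may become ready for another
  value first; at intact servers \<open>readies_intact_unique\<close> identifies it.\<close>

lemma eventually_ready:
  assumes v: "v \<in> V - F" and h: "h = Ready_on_Echo \<or> h = Ready_on_Ready"
    and en: "\<And>j. j \<ge> k \<Longrightarrow> \<not> ready (st j v) \<Longrightarrow> enabled \<Q> A c v h a (st j v)"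
  shows "\<exists>b. readies v b"
proof (rule ccontr)
  assume no: "\<nexists>b. readies v b"
  then have "\<And>j. j \<ge> k \<Longrightarrow> enabled \<Q> A c v h a (st j v)"
    using en flag_imp_event(2)[OF v] by blast
  then obtain j where "ev j = Handle v h a" using complete[OF v] by blast
  then show False using no h v unfolding readies_def by blast
qed

section \<open>Delivery by all correct servers\<close>

text \<open>\<open>I\<close> is itself a quorum of correct servers, so its \<open>READY\<close>
  messages reach every correct server and keep the deliver handler enabled until that server
  delivers.\<close>

lemma intact_ready_imp_all_deliver:
  assumes "\<And>u. u \<in> I \<Longrightarrow> readies u a" and v: "v \<in> V - F"
  shows "\<exists>b. delivers v b"
proof (rule ccontr)
  assume no: "\<nexists>b. delivers v b"
  have "\<exists>j. (u, READY a) \<in> received (st j v)" if "u \<in> I" for u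
    using readies_imp_sent[OF assms(1)[OF that], of v] sent_imp_received v that I_correct by blast
  then obtain k where "\<forall>j\<ge>k. \<forall>u\<in>I. (u, READY a) \<in> received (st j v)"
    using eventually_received_all[OF finite_subset[OF quorum_subset[OF I_quorum] finite_V]] by metis
  then have "\<And>j. j \<ge> k \<Longrightarrow> enabled \<Q> A c v Deliver_on_Ready a (st j v)"
    using no flag_imp_event(3)[OF v] I_quorum by auto
  then show False using complete[OF v] no v unfolding delivers_def by blast
qed

lemma delivers_total:
  assumes d: "delivers v a" and w: "w \<in> V - F"
  shows "delivers w a"
proof -
  obtain U where U: "U \<in> \<Q>" "\<forall>u\<in>U - F. readies u a"
    using delivers_imp_ready_quorum[OF d] by blast
  obtain u0 where u0: "u0 \<in> I" "readies u0 a"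
    using delivers_imp_intact_readies[OF d] by blast
  \<comment> \<open>\<open>W\<close> refers to the whole execution and contains the intact part of
    \<open>U\<close>. Were it smaller than \<open>I\<close>, \<open>ready_cascade\<close> would
    supply a server outside \<open>W\<close> that the messages from \<open>W\<close> eventually make
    ready, and by uniqueness for \<open>a\<close>.\<close>
  define W where "W = {u \<in> I. readies u a}"
  have "W = I"
  proof (rule ccontr)
    assume "W \<noteq> I"
    then have "W \<subset> I" unfolding W_def by blast
    have "U \<inter> I \<subseteq> W" using U(2) I_correct unfolding W_def by blast
    from ready_cascade[OF U(1) this \<open>W \<subset> I\<close>]
    obtain x B where x: "x \<in> I - W" and B: "B \<in> A x" "B \<subseteq> W" by (elim bexE)
    have xc: "x \<in> V - F" using x I_subset by blast
    have "\<exists>j. (u, READY a) \<in> received (st j x)" if "u \<in> B" for u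
    proof -
      have "readies u a" "u \<notin> F" using that B(2) I_correct unfolding W_def by auto
      then show ?thesis using readies_imp_sent[of u a x] sent_imp_received xc by blast
    qed
    moreover have "finite B"
      using B(2) \<open>W \<subset> I\<close> I_subset finite_V by (meson finite_Diff finite_subset psubset_imp_subset)
    ultimately obtain k where "\<forall>j\<ge>k. \<forall>u\<in>B. (u, READY a) \<in> received (st j x)"
      using eventually_received_all by blast
    then have "\<exists>b. readies x b"
      using B(1) by (intro eventually_ready[OF xc, of Ready_on_Ready k a]) auto
    then have "readies x a" using readies_intact_unique u0 x by blast
    then show False using x unfolding W_def by blast
  qed
  then obtain b where "delivers w b"
    using intact_ready_imp_all_deliver[of a w] w unfolding W_def by blast
  then show ?thesis using delivers_agree[OF d] by blast
qed

text \<open>The echoes reach every correct server and make it ready for some value; intact servers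
  agree on that value, and their \<open>READY\<close> messages cause delivery. The contrapositive
  serves the executions in which no correct server delivers.\<close>

lemma correct_echo_quorum_imp_delivers:
  assumes U: "U \<in> \<Q>" "\<And>u. u \<in> U \<Longrightarrow> echoes u a" and v: "v \<in> V - F"
  shows "\<exists>b. delivers v b"
proof -
  have r: "\<exists>b. readies w b" if w: "w \<in> V - F" for w
  proof -
    have "\<exists>j. (u, ECHO a) \<in> received (st j w)" if "u \<in> U" for u
      using echoes_imp_sent[OF U(2)[OF that], of w] sent_imp_received w U(2)[OF that]
      unfolding echoes_def by blast
    then obtain k where "\<forall>j\<ge>k. \<forall>u\<in>U. (u, ECHO a) \<in> received (st j w)"
      using eventually_received_all[OF finite_subset[OF quorum_subset[OF U(1)] finite_V]] by metis
    then show ?thesis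
      using U(1) by (intro eventually_ready[OF w, of Ready_on_Echo k a]) auto
  qed
  obtain u0 b where u0: "u0 \<in> I" "readies u0 b" using I_nonempty r I_subset by blast
  have "readies u b" if "u \<in> I" for u
    using r[of u] readies_intact_unique[OF u0(2,1)] that I_subset by blast
  then show ?thesis using intact_ready_imp_all_deliver v by blast
qed

section \<open>Values received from a correct sender\<close>

lemma broadcast_event:
  assumes "ev i = Broadcast a"
  shows "c \<notin> F" "\<not> has_broadcast (config_at \<rho> i)" "has_broadcast (config_at \<rho> (Suc i))"
    "w \<in> V \<Longrightarrow> (c, w, BCAST a) \<in> snt (Suc i)"
  using step_at[of i] assms by (cases, auto)+

lemma has_broadcast_mono:
  assumes "i \<le> j"
  shows "has_broadcast (config_at \<rho> i) \<Longrightarrow> has_broadcast (config_at \<rho> j)"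
  using assms
proof (induction rule: dec_induct)
  case (step n)
  show ?case using step_at[of n] by (cases, use step in auto)
qed

lemma broadcast_unique:
  assumes "ev i = Broadcast a" and "ev j = Broadcast b"
  shows "a = b"
proof -
  have "i = j"
    using broadcast_event(2,3)[OF assms(1)] broadcast_event(2,3)[OF assms(2)]
      has_broadcast_mono[of "Suc i" j] has_broadcast_mono[of "Suc j" i]
    by (metis linorder_neqE_nat Suc_leI)
  then show ?thesis using assms by simp
qed

lemma correct_sender_reception:
  assumes "c \<notin> F" and "v \<in> V - F" and "ev i = Receive v c (BCAST a)"
  shows "\<exists>j. ev j = Broadcast a"
proof -
  have "(c, v, BCAST a) \<in> snt i"
    using receive_event(1)[OF assms(3)] assms(1,2) by blast
  \<comment> \<open>A client is not a server, so the message stems from a \<open>Broadcast\<close>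
    event and not from a handler.\<close>
  from sent_imp_event[OF this] show ?thesis using clients by auto
qed

lemma correct_sender_broadcast:
  assumes "ev i = Broadcast a" and v: "v \<in> V - F"
  shows "ev j = Receive v c (BCAST b) \<Longrightarrow> b = a"
    and "\<exists>j. ev j = Receive v c (BCAST a)"
  using correct_sender_reception[OF broadcast_event(1)[OF assms(1)] v] broadcast_unique assms(1)
    reliable[OF broadcast_event(4)[OF assms(1), of v] broadcast_event(1)[OF assms(1)]] v
  by blast+

end

section \<open>Construction of executions\<close>

text \<open>The empty set would satisfy the guards vacuously; excluding it keeps
  \<open>Ready_on_Ready\<close> and \<open>Deliver_on_Ready\<close> disabled at servers that have
  received no \<open>READY\<close>.\<close>

locale broadcast_system =
  fixes C V :: "'n set" and c :: 'n and F :: "'n set" and \<Q> :: "'n set set"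
    and A :: "'n \<Rightarrow> 'n set set"
  assumes finite_V: "finite V"
    and clients: "C \<inter> V = {}" "c \<in> C"
    and quorum_subset: "U \<in> \<Q> \<Longrightarrow> U \<subseteq> V"
    and quorum_nonempty: "{} \<notin> \<Q>"
    and ready_nonempty: "{} \<notin> A v"
begin

section \<open>Finite runs and their continuation to executions\<close>

primrec run :: "('n, 'a) config \<Rightarrow> ('n, 'a) event list \<Rightarrow> ('n, 'a) config \<Rightarrow> bool" where
  "run \<sigma> [] \<sigma>' \<longleftrightarrow> \<sigma>' = \<sigma>"
| "run \<sigma> (e # es) \<sigma>' \<longleftrightarrow> (\<exists>\<tau>. step C V c F \<Q> A \<sigma> e \<tau> \<and> run \<tau> es \<sigma>')"

lemma run_append: "run \<sigma> es \<tau> \<Longrightarrow> run \<tau> es' \<sigma>' \<Longrightarrow> run \<sigma> (es @ es') \<sigma>'"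
  by (induction es arbitrary: \<sigma>) auto

lemma run_configs:
  "run \<sigma> es \<sigma>' \<Longrightarrow> \<exists>f. f 0 = \<sigma> \<and> f (length es) = \<sigma>' \<and>
     (\<forall>i<length es. step C V c F \<Q> A (f i) (es ! i) (f (Suc i)))"
proof (induction es arbitrary: \<sigma>)
  case Nil
  then show ?case by auto
next
  case (Cons e es)
  then obtain \<tau> f where "step C V c F \<Q> A \<sigma> e \<tau>" and f: "f 0 = \<tau>" "f (length es) = \<sigma>'"
    "\<forall>i<length es. step C V c F \<Q> A (f i) (es ! i) (f (Suc i))" by fastforce
  then have "step C V c F \<Q> A (case_nat \<sigma> f i) ((e # es) ! i) (case_nat \<sigma> f (Suc i))"
    if "i < length (e # es)" for i
    using that by (cases i) auto
  then show ?case using f by (intro exI[of _ "case_nat \<sigma> f"]) auto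
qed

lemma step_sent_mono: "step C V c F \<Q> A \<sigma> e \<tau> \<Longrightarrow> sent \<sigma> \<subseteq> sent \<tau>"
  by (cases rule: step.cases) auto

text \<open>The tail leaves the quiescent configuration \<open>\<sigma>\<close> unchanged, so no
  handler stays enabled and completeness holds vacuously. As \<open>sent\<close> only grows,
  reliability can be checked at \<open>\<sigma>\<close>.\<close>

lemma execution_of_run:
  assumes run: "run initial_config es \<sigma>"
    and tail: "\<And>i. step C V c F \<Q> A \<sigma> (tail i) \<sigma>"
    and reliable: "\<And>u v m. (u, v, m) \<in> sent \<sigma> \<Longrightarrow> u \<notin> F \<Longrightarrow> v \<notin> F \<Longrightarrow> Receive v u m \<in> set es"
    and quiescent: "\<And>v h a. v \<in> V - F \<Longrightarrow> \<not> enabled \<Q> A c v h a (local \<sigma> v)"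
  shows "\<exists>\<rho>. is_execution C V c F \<Q> A \<rho> \<and>
    event_at \<rho> = (\<lambda>i. if i < length es then es ! i else tail (i - length es))"
proof -
  obtain f where f: "f 0 = initial_config" "f (length es) = \<sigma>"
    "\<And>i. i < length es \<Longrightarrow> step C V c F \<Q> A (f i) (es ! i) (f (Suc i))"
    using run_configs[OF run] by blast
  define ev where "ev i = (if i < length es then es ! i else tail (i - length es))" for i
  define cf where "cf i = (if i < length es then f i else \<sigma>)" for i
  have steps: "step C V c F \<Q> A (cf i) (ev i) (cf (Suc i))" for i
  proof -
    consider "Suc i < length es" | "Suc i = length es" | "i \<ge> length es" by linarith
    then show ?thesis
    proof cases
      case 2
      then show ?thesis using f(2) f(3)[of i] by (simp add: cf_def ev_def)
    qed (simp_all add: cf_def ev_def f(3) tail)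
  qed
  have sent: "sent (cf i) \<subseteq> sent \<sigma>" for i
  proof -
    have "sent (cf i) \<subseteq> sent (cf (i + length es))"
      by (rule lift_Suc_mono_le[of "\<lambda>i. sent (cf i)"]) (auto intro: step_sent_mono[OF steps, THEN subsetD])
    then show ?thesis by (simp add: cf_def)
  qed
  have "is_execution C V c F \<Q> A \<lparr>config_at = cf, event_at = ev\<rparr>"
    unfolding is_execution_def
  proof (intro conjI allI ballI impI)
    show "config_at \<lparr>config_at = cf, event_at = ev\<rparr> 0 = initial_config"
      using f(1,2) by (cases es) (simp_all add: cf_def)
    show "step C V c F \<Q> A (config_at \<lparr>config_at = cf, event_at = ev\<rparr> i)
        (event_at \<lparr>config_at = cf, event_at = ev\<rparr> i)
        (config_at \<lparr>config_at = cf, event_at = ev\<rparr> (Suc i))" for i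
      using steps by simp
  next
    fix i u v m
    assume "(u, v, m) \<in> sent (config_at \<lparr>config_at = cf, event_at = ev\<rparr> i) \<and> u \<notin> F \<and> v \<notin> F"
    then have "Receive v u m \<in> set es" using reliable sent by fastforce
    then obtain j where "j < length es" "es ! j = Receive v u m" unfolding in_set_conv_nth by blast
    then show "\<exists>j. event_at \<lparr>config_at = cf, event_at = ev\<rparr> j = Receive v u m"
      by (intro exI[of _ j]) (simp add: ev_def)
  next
    fix v h a i
    assume v: "v \<in> V - F"
      and "\<forall>j\<ge>i. enabled \<Q> A c v h a (local (config_at \<lparr>config_at = cf, event_at = ev\<rparr> j) v)"
    then have "enabled \<Q> A c v h a (local (cf (i + length es)) v)" by simp
    then have "enabled \<Q> A c v h a (local \<sigma> v)" by (simp add: cf_def)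
    then show "\<exists>j\<ge>i. event_at \<lparr>config_at = cf, event_at = ev\<rparr> j = Handle v h a"
      using quiescent[OF v] by blast
  qed
  then show ?thesis
    by (intro exI[of _ "\<lparr>config_at = cf, event_at = ev\<rparr>"]) (auto simp: ev_def)
qed

section \<open>Batches of receptions and of handlers\<close>

text \<open>The triples in \<open>R\<close> list receiver, sender and message, as
  \<open>Receive\<close> does; \<open>sent\<close> puts the sender first.\<close>

definition receive_all :: "('n \<times> 'n \<times> 'a msg) set \<Rightarrow> ('n, 'a) config \<Rightarrow> ('n, 'a) config" where
  "receive_all R \<sigma> = \<sigma>\<lparr>local := \<lambda>v. (local \<sigma> v)
     \<lparr>received := received (local \<sigma> v) \<union> {(u, m). (v, u, m) \<in> R}\<rparr>\<rparr>"

definition handle_all ::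
  "handler \<Rightarrow> 'n set \<Rightarrow> ('n \<Rightarrow> 'a) \<Rightarrow> ('n, 'a) config \<Rightarrow> ('n, 'a) config" where
  "handle_all h W g \<sigma> = \<sigma>\<lparr>local := \<lambda>v. if v \<in> W then set_flag h (local \<sigma> v) else local \<sigma> v,
     sent := sent \<sigma> \<union> {(v, w, m). v \<in> W \<and> w \<in> V \<and> m \<in> sent_messages h (g v)}\<rparr>"

lemma sent_receive_all [simp]: "sent (receive_all R \<sigma>) = sent \<sigma>"
  by (simp add: receive_all_def)

text \<open>Receptions leave \<open>sent\<close> unchanged, so the conditions on all of
  \<open>R\<close> can be checked at \<open>\<sigma>\<close> and the order is immaterial.\<close>

lemma run_receive_all:
  assumes "finite R"
    and "\<And>v u m. (v, u, m) \<in> R \<Longrightarrow> u \<in> C \<union> V \<and> v \<in> C \<union> V \<and> (u \<notin> F \<and> v \<notin> F \<longrightarrow> (u, v, m) \<in> sent \<sigma>)"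
  shows "\<exists>es. set es = {Receive v u m | v u m. (v, u, m) \<in> R} \<and> run \<sigma> es (receive_all R \<sigma>)"
  using assms
proof (induction R)
  case empty
  have "run \<sigma> [] (receive_all {} \<sigma>)" by (simp add: receive_all_def)
  then show ?case by (intro exI[of _ "[]"]) simp
next
  case (insert x R)
  obtain v u m where x: "x = (v, u, m)" by (cases x)
  obtain es where es: "set es = {Receive v u m | v u m. (v, u, m) \<in> R}" "run \<sigma> es (receive_all R \<sigma>)"
    using insert.IH insert.prems by blast
  let ?\<tau> = "receive_all R \<sigma>"
  have "step C V c F \<Q> A ?\<tau> (Receive v u m)
      (?\<tau>\<lparr>local := (local ?\<tau>)(v := (local ?\<tau> v)\<lparr>received := insert (u, m) (received (local ?\<tau> v))\<rparr>)\<rparr>)"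
    using insert.prems[of v u m] x by (intro receive) auto
  moreover have "{(u', m'). u' = u \<and> m' = m \<or> (v, u', m') \<in> R} = insert (u, m) {(u, m). (v, u, m) \<in> R}"
    by auto
  then have "?\<tau>\<lparr>local := (local ?\<tau>)(v := (local ?\<tau> v)\<lparr>received := insert (u, m) (received (local ?\<tau> v))\<rparr>)\<rparr>
      = receive_all (insert x R) \<sigma>"
    by (auto simp: receive_all_def x fun_eq_iff)
  ultimately have "run ?\<tau> [Receive v u m] (receive_all (insert x R) \<sigma>)" by simp
  from run_append[OF es(2) this] show ?case
    by (intro exI[of _ "es @ [Receive v u m]"]) (auto simp: es(1) x)
qed

text \<open>A handler changes the local state of its own server only, so the guards of the remaining
  servers are as in \<open>\<sigma>\<close>.\<close>

lemma run_handle_all: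
  assumes "finite W" and "W \<subseteq> V - F" and "\<And>v. v \<in> W \<Longrightarrow> enabled \<Q> A c v h (g v) (local \<sigma> v)"
  shows "\<exists>es. set es = (\<lambda>v. Handle v h (g v)) ` W \<and> run \<sigma> es (handle_all h W g \<sigma>)"
  using assms
proof (induction W)
  case empty
  have "run \<sigma> [] (handle_all h {} g \<sigma>)" by (simp add: handle_all_def case_prod_unfold)
  then show ?case by (intro exI[of _ "[]"]) simp
next
  case (insert v W)
  obtain es where es: "set es = (\<lambda>v. Handle v h (g v)) ` W" "run \<sigma> es (handle_all h W g \<sigma>)"
    using insert.IH insert.prems by auto
  let ?\<tau> = "handle_all h W g \<sigma>"
  have l: "local ?\<tau> v = local \<sigma> v" using insert.hyps by (simp add: handle_all_def)
  have "step C V c F \<Q> A ?\<tau> (Handle v h (g v))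
      (?\<tau>\<lparr>local := (local ?\<tau>)(v := set_flag h (local ?\<tau> v)),
          sent := sent ?\<tau> \<union> {v} \<times> V \<times> sent_messages h (g v)\<rparr>)"
    using insert.prems by (intro handle) (auto simp: l)
  moreover have "?\<tau>\<lparr>local := (local ?\<tau>)(v := set_flag h (local ?\<tau> v)),
          sent := sent ?\<tau> \<union> {v} \<times> V \<times> sent_messages h (g v)\<rparr> = handle_all h (insert v W) g \<sigma>"
    using insert.hyps by (intro config.equality) (auto simp: handle_all_def)
  ultimately have "run ?\<tau> [Handle v h (g v)] (handle_all h (insert v W) g \<sigma>)" by simp
  from run_append[OF es(2) this] show ?case
    by (intro exI[of _ "es @ [Handle v h (g v)]"]) (auto simp: es(1))
qed

text \<open>Within the prefix, \<open>f v\<close> is the only value that \<open>v\<close> receives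
  from \<open>c\<close>, so it comes first even if later receptions carry other values.\<close>

lemma first_reception:
  fixes ev :: "nat \<Rightarrow> ('n, 'a) event"
  assumes prefix: "\<And>i. i < length xs \<Longrightarrow> ev i = xs ! i"
    and in_prefix: "\<And>a. Receive v c (BCAST a) \<in> set xs \<longleftrightarrow> v \<in> X \<and> a = f v"
    and not_later: "\<And>i a. v \<notin> X \<Longrightarrow> ev i \<noteq> Receive v c (BCAST a)"
  shows "(\<exists>i. ev i = Receive v c (BCAST a) \<and> (\<forall>j<i. \<forall>b. ev j \<noteq> Receive v c (BCAST b)))
    \<longleftrightarrow> v \<in> X \<and> a = f v" (is "?L \<longleftrightarrow> _")
proof (cases "v \<in> X")
  case True
  let ?P = "\<lambda>i. \<exists>b. ev i = Receive v c (BCAST b)"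
  obtain i where i: "i < length xs" "ev i = Receive v c (BCAST (f v))"
    using in_prefix[of "f v"] True prefix unfolding in_set_conv_nth by fastforce
  define k where "k = (LEAST i. ?P i)"
  have least: "?P k" "\<And>j. j < k \<Longrightarrow> \<not> ?P j"
    unfolding k_def using LeastI[of ?P i] i(2) not_less_Least[of _ ?P] by blast+
  then have "k \<le> i" using i(2) by (meson not_le)
  then have "ev k = xs ! k" "k < length xs" using i(1) prefix by auto
  then have "\<And>b. ev k = Receive v c (BCAST b) \<Longrightarrow> b = f v"
    using in_prefix nth_mem by metis
  then have k: "ev k = Receive v c (BCAST (f v))" using least(1) by blast
  have "?L \<longleftrightarrow> ev k = Receive v c (BCAST a)"
    using least k by (metis linorder_neqE_nat)
  then show ?thesis using k True by auto
qed (use not_later in blast)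

text \<open>\<open>X\<close> holds the servers that receive a \<open>BCAST\<close>, \<open>f\<close>
  the values received first and \<open>e\<close> the values echoed. The last two may differ under a
  faulty sender, as a server may echo a later value. \<open>W\<close> holds the correct servers that
  deliver \<open>a\<close>, and \<open>tail\<close> the deliveries by faulty servers.\<close>

lemma execution_exists:
  fixes f e :: "'n \<Rightarrow> 'a" and tail :: "nat \<Rightarrow> ('n, 'a) event"
  assumes X: "X \<subseteq> V"
    and sender: "c \<notin> F \<Longrightarrow> X - F = {} \<or> (\<exists>b. X - F = V - F \<and> (\<forall>v\<in>V - F. f v = b \<and> e v = b))"
    and W: "W = {} \<or> W = V - F"
    and echo_quorum: "W \<noteq> {} \<Longrightarrow> U \<in> \<Q> \<and> (\<forall>u\<in>U - F. u \<in> X \<and> e u = a)"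
    and correct_quorum: "W \<noteq> {} \<Longrightarrow> \<exists>I\<in>\<Q>. I \<inter> F = {}"
    and no_echo_quorum: "\<And>U b. W = {} \<Longrightarrow> U \<in> \<Q> \<Longrightarrow> \<not> (\<forall>u\<in>U. u \<in> X - F \<and> e u = b)"
    and tail: "\<And>i. tail i = Idle \<or> (\<exists>v\<in>V \<inter> F. \<exists>h b. tail i = Handle v h b)"
  shows "\<exists>\<rho>. is_execution C V c F \<Q> A \<rho> \<and>
    history V c \<rho> = {First_Bcast v (f v) | v. v \<in> X} \<union> {Deliver v a | v. v \<in> W} \<union>
      {Deliver v b | v b. v \<in> V \<inter> F \<and> (\<exists>i. tail i = Handle v Deliver_on_Ready b)}"
proof -
  have finX: "finite X" "finite (X - F)" and finW: "finite W" and WV: "W \<subseteq> V - F"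
    using finite_subset[OF X finite_V] W finite_V by auto
  obtain es1 \<sigma>1 where es1: "run initial_config es1 \<sigma>1" "set es1 \<subseteq> range Broadcast"
    and local1: "local \<sigma>1 = (\<lambda>_. \<lparr>received = {}, echoed = False, ready = False, delivered = False\<rparr>)"
    and sent1: "\<And>v. c \<notin> F \<Longrightarrow> v \<in> X - F \<Longrightarrow>
        (c, v, BCAST (f v)) \<in> sent \<sigma>1 \<and> (c, v, BCAST (e v)) \<in> sent \<sigma>1"
      "\<And>u v m. (u, v, m) \<in> sent \<sigma>1 \<Longrightarrow> u = c \<and> v \<in> V \<and> (v \<notin> F \<longrightarrow> v \<in> X \<and> m = BCAST (f v))"
  \<comment> \<open>A correct sender broadcasts only if some correct server is to receive its value;
    otherwise it stays silent, so that reliability forces no reception.\<close>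
  proof (cases "c \<notin> F \<and> X - F \<noteq> {}")
    case True
    then obtain b where b: "X - F = V - F" "\<forall>v\<in>V - F. f v = b \<and> e v = b" using sender by blast
    let ?\<sigma> = "initial_config\<lparr>has_broadcast := True,
        sent := sent initial_config \<union> {c} \<times> V \<times> {BCAST b}\<rparr> :: ('n, 'a) config"
    have "step C V c F \<Q> A initial_config (Broadcast b) ?\<sigma>"
      using True by (intro broadcast) (auto simp: initial_config_def)
    then have "run initial_config [Broadcast b] ?\<sigma>" by simp
    then show thesis
      using b by (intro that[of "[Broadcast b]" ?\<sigma>]) (auto simp: initial_config_def)
  next
    case False
    then show thesis
      by (intro that[of "[]" initial_config]) (auto simp: initial_config_def)
  qed
  \<comment> \<open>\<open>R2\<close> holds the first receptions and the later \<open>R3\<close> the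
    values to be echoed. \<open>R5\<close> holds the genuine echoes and the forged ones by which
    faulty members complete the quorum \<open>U\<close> at the servers in \<open>W\<close>.
    \<open>R7\<close> holds the \<open>READY\<close> messages within \<open>W\<close>.\<close>
  define R2 where "R2 = (\<lambda>v. (v, c, BCAST (f v))) ` X"
  define R3 where "R3 = (\<lambda>v. (v, c, BCAST (e v))) ` (X - F)"
  define R5 where "R5 = (\<lambda>(v, u). (v, u, ECHO (e u))) ` ((V - F) \<times> (X - F)) \<union>
    (\<lambda>(v, u). (v, u, ECHO a)) ` (W \<times> (V \<inter> U \<inter> F))"
  define R7 where "R7 = (\<lambda>(v, u). (v, u, READY a)) ` (W \<times> W)"
  define \<sigma>2 where "\<sigma>2 = receive_all R2 \<sigma>1"
  define \<sigma>3 where "\<sigma>3 = receive_all R3 \<sigma>2"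
  define \<sigma>4 where "\<sigma>4 = handle_all Echo_on_Bcast (X - F) e \<sigma>3"
  define \<sigma>5 where "\<sigma>5 = receive_all R5 \<sigma>4"
  define \<sigma>6 where "\<sigma>6 = handle_all Ready_on_Echo W (\<lambda>_. a) \<sigma>5"
  define \<sigma>7 where "\<sigma>7 = receive_all R7 \<sigma>6"
  define \<sigma>8 where "\<sigma>8 = handle_all Deliver_on_Ready W (\<lambda>_. a) \<sigma>7"
  note defs = local1 \<sigma>2_def \<sigma>3_def \<sigma>4_def \<sigma>5_def \<sigma>6_def \<sigma>7_def \<sigma>8_def receive_all_def handle_all_def
  note Rs = R2_def R3_def R5_def R7_def

  \<comment> \<open>Execution of the rounds\<close>
  have "finite R2" "finite R3" "finite R5" "finite R7"
    using finX finW finite_V by (auto simp: Rs)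
  note fin = this
  obtain es2 where es2: "set es2 = {Receive v u m | v u m. (v, u, m) \<in> R2}" "run \<sigma>1 es2 \<sigma>2"
    using run_receive_all[OF fin(1), of \<sigma>1] X sent1(1) clients unfolding R2_def \<sigma>2_def by blast
  obtain es3 where es3: "set es3 = {Receive v u m | v u m. (v, u, m) \<in> R3}" "run \<sigma>2 es3 \<sigma>3"
    using run_receive_all[OF fin(2), of \<sigma>2] X sent1(1) clients unfolding R3_def \<sigma>3_def \<sigma>2_def
      sent_receive_all by blast
  have "enabled \<Q> A c v Echo_on_Bcast (e v) (local \<sigma>3 v)" if "v \<in> X - F" for v
    using that by (simp add: defs Rs)
  then obtain es4 where es4: "set es4 = (\<lambda>v. Handle v Echo_on_Bcast (e v)) ` (X - F)" "run \<sigma>3 es4 \<sigma>4"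
    using run_handle_all[of "X - F" Echo_on_Bcast e \<sigma>3] finX X unfolding \<sigma>4_def by blast
  have "u \<in> C \<union> V \<and> v \<in> C \<union> V \<and> (u \<notin> F \<and> v \<notin> F \<longrightarrow> (u, v, m) \<in> sent \<sigma>4)"
    if "(v, u, m) \<in> R5" for v u m
    using that X WV by (auto simp: R5_def \<sigma>4_def handle_all_def)
  from run_receive_all[OF fin(3) this] obtain es5 where
    es5: "set es5 = {Receive v u m | v u m. (v, u, m) \<in> R5}" "run \<sigma>4 es5 \<sigma>5"
    unfolding \<sigma>5_def by blast
  have "enabled \<Q> A c v Ready_on_Echo a (local \<sigma>5 v)" if "v \<in> W" for v
  proof -
    have U: "U \<in> \<Q>" "\<forall>u\<in>U - F. u \<in> X \<and> e u = a" using echo_quorum that by auto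
    have "(v, u, ECHO a) \<in> R5" if u: "u \<in> U" for u
    proof (cases "u \<in> F")
      case True
      then show ?thesis using u \<open>v \<in> W\<close> quorum_subset[OF U(1)] by (auto simp: R5_def)
    next
      case False
      then have "u \<in> X - F" "e u = a" using U(2) u by auto
      then show ?thesis using \<open>v \<in> W\<close> WV by (auto simp: R5_def)
    qed
    then have "\<forall>u\<in>U. (u, ECHO a) \<in> received (local \<sigma>5 v)"
      by (simp add: \<sigma>5_def receive_all_def)
    moreover have "\<not> ready (local \<sigma>5 v)" by (simp add: defs)
    ultimately show ?thesis using U(1) by auto
  qed
  from run_handle_all[OF finW WV this] obtain es6 where
    es6: "set es6 = (\<lambda>v. Handle v Ready_on_Echo a) ` W" "run \<sigma>5 es6 \<sigma>6"
    unfolding \<sigma>6_def by blast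
  have "u \<in> C \<union> V \<and> v \<in> C \<union> V \<and> (u \<notin> F \<and> v \<notin> F \<longrightarrow> (u, v, m) \<in> sent \<sigma>6)"
    if "(v, u, m) \<in> R7" for v u m
    using that WV by (auto simp: R7_def \<sigma>6_def handle_all_def)
  from run_receive_all[OF fin(4) this] obtain es7 where
    es7: "set es7 = {Receive v u m | v u m. (v, u, m) \<in> R7}" "run \<sigma>6 es7 \<sigma>7"
    unfolding \<sigma>7_def by blast
  have "enabled \<Q> A c v Deliver_on_Ready a (local \<sigma>7 v)" if v: "v \<in> W" for v
  proof -
    obtain I where I: "I \<in> \<Q>" "I \<inter> F = {}" using correct_quorum v by auto
    \<comment> \<open>Being non-empty, \<open>W\<close> consists of all correct servers, so genuine
      \<open>READY\<close> messages alone come from a quorum.\<close>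
    have "I \<subseteq> W" using I quorum_subset[OF I(1)] W v by auto
    then have "\<forall>u\<in>I. (u, READY a) \<in> received (local \<sigma>7 v)"
      using v by (auto simp: \<sigma>7_def receive_all_def R7_def)
    moreover have "\<not> delivered (local \<sigma>7 v)" by (simp add: defs)
    ultimately show ?thesis using I(1) by auto
  qed
  from run_handle_all[OF finW WV this] obtain es8 where
    es8: "set es8 = (\<lambda>v. Handle v Deliver_on_Ready a) ` W" "run \<sigma>7 es8 \<sigma>8"
    unfolding \<sigma>8_def by blast
  \<comment> \<open>The bracketing displays the prefix \<open>es1 @ es2\<close>, which settles the
    first receptions.\<close>
  define es where "es = (es1 @ es2) @ es3 @ es4 @ es5 @ es6 @ es7 @ es8"
  have run: "run initial_config es \<sigma>8"
    unfolding es_def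
    by (rule run_append[OF run_append[OF es1(1) es2(2)] run_append[OF es3(2)
      run_append[OF es4(2) run_append[OF es5(2) run_append[OF es6(2) run_append[OF es7(2) es8(2)]]]]]])
  have tail_step: "step C V c F \<Q> A \<sigma>8 (tail i) \<sigma>8" for i
    using tail[of i] by (auto intro: idle faulty)

  \<comment> \<open>Reliability and quiescence\<close>
  have sent8: "sent \<sigma>8 = sent \<sigma>1 \<union> {(v, w, m). v \<in> X - F \<and> w \<in> V \<and> m = ECHO (e v)} \<union>
      {(v, w, m). v \<in> W \<and> w \<in> V \<and> m = READY a}"
    by (auto simp: \<sigma>2_def \<sigma>3_def \<sigma>4_def \<sigma>5_def \<sigma>6_def \<sigma>7_def \<sigma>8_def receive_all_def handle_all_def)
  have reliable: "Receive v u m \<in> set es"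
    if uvm: "(u, v, m) \<in> sent \<sigma>8" "u \<notin> F" "v \<notin> F" for u v m
  proof -
    consider "(u, v, m) \<in> sent \<sigma>1" | "u \<in> X - F" "v \<in> V" "m = ECHO (e u)"
      | "u \<in> W" "v \<in> V" "m = READY a"
      using uvm(1) unfolding sent8 by blast
    then have "(v, u, m) \<in> R2 \<union> R5 \<union> R7"
    proof cases
      case 1
      then show ?thesis using sent1(2)[OF 1] uvm by (auto simp: R2_def)
    next
      case 2
      then show ?thesis using uvm by (auto simp: R5_def)
    next
      case 3
      then have "v \<in> W" using W uvm by auto
      then show ?thesis using 3 by (auto simp: R7_def)
    qed
    then show ?thesis unfolding es_def set_append es2(1) es5(1) es7(1) by blast
  qed
  have local8: "received (local \<sigma>8 v) = {(u, m). (v, u, m) \<in> R2 \<union> R3 \<union> R5 \<union> R7}"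
    "echoed (local \<sigma>8 v) \<longleftrightarrow> v \<in> X - F" "ready (local \<sigma>8 v) \<longleftrightarrow> v \<in> W"
    "delivered (local \<sigma>8 v) \<longleftrightarrow> v \<in> W" for v
    by (auto simp: defs)
  \<comment> \<open>Every correct receiver of a \<open>BCAST\<close> has echoed. If \<open>W\<close>
    consists of all correct servers, their flags \<open>ready\<close> and \<open>delivered\<close>
    are set; if \<open>W\<close> is empty, no \<open>READY\<close> and no forged \<open>ECHO\<close>
    has been received.\<close>
  have quiescent: "\<not> enabled \<Q> A c v h b (local \<sigma>8 v)" if v: "v \<in> V - F" for v h b
  proof (cases h)
    case Echo_on_Bcast
    then show ?thesis using v by (auto simp: local8 Rs)
  next
    case Ready_on_Echo
    show ?thesis
    proof
      assume "enabled \<Q> A c v h b (local \<sigma>8 v)"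
      then obtain U' where U': "U' \<in> \<Q>" "\<forall>u\<in>U'. (u, ECHO b) \<in> received (local \<sigma>8 v)" and "v \<notin> W"
        using Ready_on_Echo by (auto simp: local8(3))
      then have "W = {}" using W v by auto
      moreover from this have "\<forall>u\<in>U'. u \<in> X - F \<and> e u = b"
        using U'(2) by (auto simp: local8(1) Rs)
      ultimately show False using no_echo_quorum U'(1) by blast
    qed
  next
    case Ready_on_Ready
    show ?thesis
    proof
      assume "enabled \<Q> A c v h b (local \<sigma>8 v)"
      then obtain B where B: "B \<in> A v" "\<forall>u\<in>B. (u, READY b) \<in> received (local \<sigma>8 v)" and "v \<notin> W"
        using Ready_on_Ready by (auto simp: local8(3))
      then have "W = {}" using W v by auto
      then have "B = {}" using B(2) by (auto simp: local8(1) Rs)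
      then show False using B(1) ready_nonempty by auto
    qed
  next
    case Deliver_on_Ready
    show ?thesis
    proof
      assume "enabled \<Q> A c v h b (local \<sigma>8 v)"
      then obtain B where B: "B \<in> \<Q>" "\<forall>u\<in>B. (u, READY b) \<in> received (local \<sigma>8 v)" and "v \<notin> W"
        using Deliver_on_Ready by (auto simp: local8(4))
      then have "W = {}" using W v by auto
      then have "B = {}" using B(2) by (auto simp: local8(1) Rs)
      then show False using B(1) quorum_nonempty by auto
    qed
  qed

  \<comment> \<open>The history of the constructed execution\<close>
  have "\<exists>\<rho>. is_execution C V c F \<Q> A \<rho> \<and>
      event_at \<rho> = (\<lambda>i. if i < length es then es ! i else tail (i - length es))"
    by (rule execution_of_run[OF run]) (fact tail_step reliable quiescent)+
  then obtain \<rho> where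
    \<rho>: "is_execution C V c F \<Q> A \<rho>"
    "event_at \<rho> = (\<lambda>i. if i < length es then es ! i else tail (i - length es))"
    by (elim exE conjE)
  have occurs: "(\<exists>i. event_at \<rho> i = x) \<longleftrightarrow> x \<in> set es \<or> (\<exists>i. tail i = x)" for x
  proof
    assume "x \<in> set es \<or> (\<exists>i. tail i = x)"
    then show "\<exists>i. event_at \<rho> i = x"
    proof
      assume "\<exists>i. tail i = x"
      then obtain i where "tail i = x" by blast
      then have "event_at \<rho> (length es + i) = x" by (simp add: \<rho>(2))
      then show ?thesis by blast
    qed (auto simp: \<rho>(2) in_set_conv_nth)
  next
    assume "\<exists>i. event_at \<rho> i = x"
    then obtain i where "event_at \<rho> i = x" by blast
    then show "x \<in> set es \<or> (\<exists>i. tail i = x)"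
      by (cases "i < length es") (auto simp: \<rho>(2))
  qed
  have first: "(\<exists>i. event_at \<rho> i = Receive v c (BCAST b) \<and>
      (\<forall>j<i. \<forall>b. event_at \<rho> j \<noteq> Receive v c (BCAST b))) \<longleftrightarrow> v \<in> X \<and> b = f v" for v b
  proof (rule first_reception[of "es1 @ es2"])
    show "event_at \<rho> i = (es1 @ es2) ! i" if "i < length (es1 @ es2)" for i
    proof -
      have "event_at \<rho> i = es ! i" using that by (simp add: \<rho>(2) es_def)
      also have "\<dots> = (es1 @ es2) ! i" unfolding es_def using that by (rule nth_append_left)
      finally show ?thesis .
    qed
    show "Receive v c (BCAST b) \<in> set (es1 @ es2) \<longleftrightarrow> v \<in> X \<and> b = f v" for b
      using es1(2) by (auto simp: es2(1) R2_def)
    show "event_at \<rho> i \<noteq> Receive v c (BCAST b)" if "v \<notin> X" for i b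
    proof
      assume "event_at \<rho> i = Receive v c (BCAST b)"
      then have "Receive v c (BCAST b) \<in> set es \<or> (\<exists>j. tail j = Receive v c (BCAST b))"
        using occurs by blast
      moreover have "Receive v c (BCAST b) \<notin> set es"
        using that es1(2) unfolding es_def set_append es2(1) es3(1) es4(1) es5(1) es6(1) es7(1) es8(1)
        by (auto simp: Rs)
      moreover have "tail j \<noteq> Receive v c (BCAST b)" for j
        using tail[of j] by auto
      ultimately show False by blast
    qed
  qed
  have deliver: "(\<exists>i. event_at \<rho> i = Handle v Deliver_on_Ready b) \<longleftrightarrow>
      v \<in> W \<and> b = a \<or> (\<exists>i. tail i = Handle v Deliver_on_Ready b)" for v b
  proof -
    have "Handle v Deliver_on_Ready b \<in> set es \<longleftrightarrow> v \<in> W \<and> b = a"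
      using es1(2) unfolding es_def set_append es2(1) es3(1) es4(1) es5(1) es6(1) es7(1) es8(1)
      by auto
    then show ?thesis unfolding occurs by simp
  qed
  have "v \<in> V \<inter> F" if "tail i = Handle v h b" for i v h b
    using tail[of i] that by auto
  then have "history V c \<rho> = {First_Bcast v (f v) | v. v \<in> X} \<union> {Deliver v a | v. v \<in> W} \<union>
      {Deliver v b | v b. v \<in> V \<inter> F \<and> (\<exists>i. tail i = Handle v Deliver_on_Ready b)}"
    unfolding history_def first deliver using X WV by blast
  with \<rho>(1) show ?thesis by blast
qed

end

section \<open>Equivalence of the protocols\<close>

text \<open>Deliveries are split by correctness because only those of correct servers obey the
  protocol; the others are copied into the new execution.\<close>

lemma (in protocol_execution) history_eq:
  "history V c \<rho> = {First_Bcast v a | v a. v \<in> V \<and>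
        (\<exists>i. ev i = Receive v c (BCAST a) \<and> (\<forall>j<i. \<forall>b. ev j \<noteq> Receive v c (BCAST b)))} \<union>
     {Deliver v a | v a. delivers v a} \<union>
     {Deliver v a | v a. v \<in> V \<inter> F \<and> (\<exists>i. ev i = Handle v Deliver_on_Ready a)}"
  unfolding history_def delivers_def by blast

lemma (in protocol_execution) first_bcast_exists:
  assumes "ev i = Receive v c (BCAST a)"
  shows "\<exists>b i. ev i = Receive v c (BCAST b) \<and> (\<forall>j<i. \<forall>b. ev j \<noteq> Receive v c (BCAST b))"
proof -
  let ?P = "\<lambda>i. \<exists>b. ev i = Receive v c (BCAST b)"
  have "?P (LEAST i. ?P i)" using LeastI[of ?P i] assms by blast
  moreover have "\<forall>j<LEAST i. ?P i. \<not> ?P j" using not_less_Least[of _ ?P] by blast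
  ultimately show ?thesis by blast
qed

text \<open>The new execution never runs \<open>Ready_on_Ready\<close>, so all that is asked of the
  families \<open>A'\<close> is that the empty set does not enable this handler.\<close>

lemma transfer_execution:
  fixes \<rho> :: "('n, 'a) execution"
  assumes "ready_families C V c F I \<Q> A" and "is_execution C V c F \<Q> A \<rho>"
    and A': "\<And>v. {} \<notin> A' v"
  shows "\<exists>\<rho>' :: ('n, 'a) execution. is_execution C V c F \<Q> A' \<rho>' \<and> history V c \<rho>' = history V c \<rho>"
proof -
  interpret protocol_execution C V c F I \<Q> A \<rho>
    using assms(1,2) by (simp add: protocol_execution_def protocol_execution_axioms_def)
  have "{} \<notin> \<Q>" using quorums_meet by blast
  interpret new: broadcast_system C V c F \<Q> A'
    using finite_V clients quorum_subset \<open>{} \<notin> \<Q>\<close> A' by unfold_locales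
  define fst_bcast where "fst_bcast v a \<longleftrightarrow>
    (\<exists>i. ev i = Receive v c (BCAST a) \<and> (\<forall>j<i. \<forall>b. ev j \<noteq> Receive v c (BCAST b)))" for v a
  define X where "X = {v \<in> V. \<exists>i a. ev i = Receive v c (BCAST a)}"
  \<comment> \<open>The choices matter for \<open>v\<close> in \<open>X\<close>, for
    \<open>v\<close> in \<open>X - F\<close> and for non-empty \<open>W\<close> respectively;
    elsewhere they are arbitrary.\<close>
  define f where "f v = (SOME a. fst_bcast v a)" for v
  define e where "e v = (SOME a. echoes v a)" for v
  define W where "W = {v. \<exists>a. delivers v a}"
  define a where "a = (SOME a. \<exists>v. delivers v a)"
  \<comment> \<open>Every event but the \<open>Handle\<close> events of faulty servers becomes
    \<open>Idle\<close> in place, which retains even infinitely many faulty deliveries.\<close>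
  define tail where "tail i = (case ev i of Handle v h b \<Rightarrow> if v \<in> V \<inter> F then ev i else Idle
    | _ \<Rightarrow> Idle)" for i
  have fst_bcast_unique: "fst_bcast v a \<Longrightarrow> fst_bcast v b \<Longrightarrow> a = b" for v a b
    unfolding fst_bcast_def by (metis event.inject(2) linorder_neqE_nat msg.inject(1))
  have f: "fst_bcast v (f v)" if "v \<in> X" for v
    unfolding f_def using that first_bcast_exists
    unfolding X_def fst_bcast_def[symmetric] by (blast intro: someI_ex)
  have f_iff: "v \<in> V \<and> fst_bcast v b \<longleftrightarrow> v \<in> X \<and> b = f v" for v b
    using f fst_bcast_unique unfolding X_def fst_bcast_def by blast
  have e: "echoes v (e v)" if "v \<in> X - F" for v
    unfolding e_def using that bcast_imp_echoes unfolding X_def by (blast intro: someI_ex)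
  have e_iff: "echoes v b \<longleftrightarrow> v \<in> X - F \<and> e v = b" for v b
  proof
    assume "echoes v b"
    moreover from this have "v \<in> X - F"
      using echoes_imp_bcast unfolding X_def echoes_def by blast
    ultimately show "v \<in> X - F \<and> e v = b" using e echoes_unique by blast
  qed (use e in auto)
  have a: "\<exists>w. delivers w a" if "delivers v b" for v b
  proof -
    from that have "\<exists>x v. delivers v x" by blast
    from someI_ex[OF this] show ?thesis unfolding a_def .
  qed
  have a_iff: "delivers v b \<longleftrightarrow> v \<in> W \<and> b = a" for v b
  proof
    assume d: "delivers v b"
    then show "v \<in> W \<and> b = a" using a delivers_agree unfolding W_def by blast
  next
    assume w: "v \<in> W \<and> b = a"
    then obtain x where x: "delivers v x" unfolding W_def by blast
    then show "delivers v b" using a w delivers_agree by blast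
  qed
  have W: "W = {} \<or> W = V - F"
  proof (cases "W = {}")
    case False
    then show ?thesis using delivers_total unfolding W_def delivers_def by blast
  qed simp
  obtain U where U: "W \<noteq> {} \<Longrightarrow> U \<in> \<Q> \<and> (\<forall>u\<in>U - F. u \<in> X \<and> e u = a)"
  proof (cases "W = {}")
    case False
    then obtain v where "delivers v a" using a_iff by blast
    from delivers_imp_echo_quorum[OF this] show thesis
      using that e_iff by blast
  qed (use that in blast)
  have sender: "X - F = {} \<or> (\<exists>b. X - F = V - F \<and> (\<forall>v\<in>V - F. f v = b \<and> e v = b))"
    if "c \<notin> F"
  proof (cases "X - F = {}")
    case False
    then obtain v i b where "v \<in> V - F" "ev i = Receive v c (BCAST b)" unfolding X_def by blast
    then obtain j b where j: "ev j = Broadcast b" using correct_sender_reception[OF \<open>c \<notin> F\<close>] by blast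
    \<comment> \<open>The single value of a correct sender reaches all correct servers, so it is
      both the first value received and the value echoed.\<close>
    have "X - F = V - F" using correct_sender_broadcast(2)[OF j] unfolding X_def by blast
    moreover have "f v = b" "e v = b" if v: "v \<in> V - F" for v
    proof -
      have vX: "v \<in> X - F" using v calculation by blast
      then show "f v = b"
        using f[of v] correct_sender_broadcast(1)[OF j v] unfolding fst_bcast_def by blast
      show "e v = b"
        using echoes_imp_bcast[OF e[OF vX]] correct_sender_broadcast(1)[OF j v] by blast
    qed
    ultimately show ?thesis by blast
  qed simp
  have no_quorum: "\<not> (\<forall>u\<in>U. u \<in> X - F \<and> e u = b)" if "W = {}" "U \<in> \<Q>" for U b
  proof
    assume "\<forall>u\<in>U. u \<in> X - F \<and> e u = b"
    then have "\<And>u. u \<in> U \<Longrightarrow> echoes u b" using e_iff by blast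
    then have "\<exists>d. delivers v d" if "v \<in> V - F" for v
      using correct_echo_quorum_imp_delivers[OF \<open>U \<in> \<Q>\<close>] that by blast
    then show False using \<open>W = {}\<close> I_nonempty I_subset unfolding W_def by blast
  qed
  have tail: "tail i = Idle \<or> (\<exists>v\<in>V \<inter> F. \<exists>h b. tail i = Handle v h b)" for i
    unfolding tail_def by (auto split: event.split)
  have tail_iff: "tail i = Handle v h b \<longleftrightarrow> ev i = Handle v h b" if "v \<in> V \<inter> F" for i v h b
    using that unfolding tail_def by (auto split: event.split)
  have "X \<subseteq> V" unfolding X_def by blast
  have "\<exists>I\<in>\<Q>. I \<inter> F = {}" using I_quorum I_correct by blast
  from new.execution_exists[where tail = tail, OF \<open>X \<subseteq> V\<close> sender W U this no_quorum tail] obtain \<rho>' where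
    \<rho>': "is_execution C V c F \<Q> A' \<rho>'"
    "history V c \<rho>' = {First_Bcast v (f v) | v. v \<in> X} \<union> {Deliver v a | v. v \<in> W} \<union>
      {Deliver v b | v b. v \<in> V \<inter> F \<and> (\<exists>i. tail i = Handle v Deliver_on_Ready b)}"
    by auto
  have "history V c \<rho> = {First_Bcast v b | v b. v \<in> V \<and> fst_bcast v b} \<union>
     {Deliver v b | v b. delivers v b} \<union>
     {Deliver v b | v b. v \<in> V \<inter> F \<and> (\<exists>i. ev i = Handle v Deliver_on_Ready b)}"
    unfolding history_eq fst_bcast_def ..
  also have "\<dots> = history V c \<rho>'"
    unfolding \<rho>'(2) f_iff a_iff using tail_iff by blast
  finally show ?thesis using \<rho>'(1) by auto
qed

theorem theorem18:
  fixes C V F :: "'n set"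
    and c :: 'n
    and S :: "'n \<Rightarrow> 'n set set"
    and Q \<B> :: "'n set set"
  assumes "finite V" and "V \<noteq> {}" and "C \<inter> V = {}" and "c \<in> C"
    and "fbqs V S" and "quorum_intersection V S"
    and "F \<subseteq> C \<union> V"
    and "intact V S (F \<inter> V) \<noteq> {}"
    and "(Q, \<B>) = induced_dqs V S"
  shows "(\<forall>(\<rho> :: ('n, 'a) execution) H.
           bracha_execution C V c F (Q, \<B>) \<rho> \<and> history V c \<rho> = H \<longrightarrow>
           (\<exists>\<rho>' :: ('n, 'a) execution.
              relaxed_stellar_execution C V c F S \<rho>' \<and> history V c \<rho>' = H)) \<and>
         (\<forall>(\<rho> :: ('n, 'a) execution) H.
           relaxed_stellar_execution C V c F S \<rho> \<and> history V c \<rho> = H \<longrightarrow>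
           (\<exists>\<rho>' :: ('n, 'a) execution.
              bracha_execution C V c F (Q, \<B>) \<rho>' \<and> history V c \<rho>' = H))"
proof -
  let ?I = "intact V S (F \<inter> V)"
  let ?bracha = "\<lambda>v::'n. {B. B \<noteq> {} \<and> B \<subseteq> V \<and> (\<forall>B'\<in>\<B>. \<not> B \<subseteq> B')}"
  let ?stellar = "\<lambda>v::'n. {B. B \<noteq> {} \<and> B \<subseteq> V \<and> blocking S v B}"
  note fin = assms(1) and qi = assms(6) and ne = assms(8)
  have Q: "Q = {U. quorum V S U}" and \<B>: "\<B> = snd (induced_dqs V S)"
    using assms(9) by (simp_all add: induced_dqs_def prod_eq_iff)
  have I: "quorum V S ?I" "?I \<subseteq> V" "?I \<inter> F = {}"
    using intact_quorum[OF fin qi ne] intact_disjoint[OF fin qi ne] by (auto simp: quorum_def)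
  have families: "ready_families C V c F ?I Q A"
    if "\<And>v B. v \<in> ?I \<Longrightarrow> B \<in> A v \<Longrightarrow> B \<inter> ?I \<noteq> {}"
      and "\<And>U W. quorum V S U \<Longrightarrow> U \<inter> ?I \<subseteq> W \<Longrightarrow> W \<subset> ?I \<Longrightarrow> \<exists>v\<in>?I - W. \<exists>B\<in>A v. B \<subseteq> W" for A
    using that assms(1,3,4) I quorums_meet_in_intact[OF fin qi ne]
    by unfold_locales (auto simp: Q quorum_def)
  have bracha: "ready_families C V c F ?I Q ?bracha"
  proof (rule families)
    show "B \<inter> ?I \<noteq> {}" if "B \<in> ?bracha v" for v :: 'n and B
      using that induced_meets_intact[OF fin qi ne, of B] by (auto simp: \<B>)
  next
    fix U W assume U: "quorum V S U" "U \<inter> ?I \<subseteq> W" and "W \<subset> ?I"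
    \<comment> \<open>By consistency of \<open>U\<close> with the quorum \<open>?I\<close>, no
      fail-prone set contains \<open>U \<inter> ?I\<close>. Every server therefore accepts this set,
      and the cascade is over in one round.\<close>
    have "U \<inter> ?I \<in> ?bracha v" for v :: 'n
      using induced_consistency[OF fin qi U(1) I(1)] quorums_meet_in_intact[OF fin qi ne U(1) U(1)] I(2)
      by (auto simp: \<B>)
    then show "\<exists>v\<in>?I - W. \<exists>B\<in>?bracha v. B \<subseteq> W"
      using U(2) \<open>W \<subset> ?I\<close> by blast
  qed
  have stellar: "ready_families C V c F ?I Q ?stellar"
  proof (rule families)
    show "B \<inter> ?I \<noteq> {}" if "v \<in> ?I" "B \<in> ?stellar v" for v B
      using blocking_meets_intact[OF fin qi that(1)] that(2) by simp
  next
    fix U W assume U: "quorum V S U" "U \<inter> ?I \<subseteq> W" and W: "W \<subset> ?I"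
    obtain v where "v \<in> ?I - W" "blocking S v W"
      using blocking_cascade[OF fin qi U W] by (elim bexE)
    \<comment> \<open>The handler asks for a non-empty blocking set; \<open>W\<close> contains the
      intact part of \<open>U\<close>, which is non-empty.\<close>
    moreover have "W \<noteq> {}"
      using quorums_meet_in_intact[OF fin qi ne U(1) U(1)] U(2) by auto
    ultimately have "W \<in> ?stellar v" using W I(2) by auto
    then show "\<exists>v\<in>?I - W. \<exists>B\<in>?stellar v. B \<subseteq> W"
      using \<open>v \<in> ?I - W\<close> by blast
  qed
  \<comment> \<open>Each protocol provides the families \<open>A\<close> in one direction and
    \<open>A'\<close> in the other.\<close>
  show ?thesis
    unfolding bracha_execution_def relaxed_stellar_execution_def fst_conv snd_conv Q[symmetric]
    using transfer_execution[OF bracha, of _ ?stellar] transfer_execution[OF stellar, of _ ?bracha]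
    by auto
qed

end
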